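(* Let $g \geq 2$ be an integer and let $\tilde{\mathcal{R}} = \bigoplus_i \tilde{\mathcal{R}}^i$ be the graded $\mathbb{Q}$-algebra defined in the context (it depends only on $g$). Then $\tilde{\mathcal{R}}$ is generated as a $\mathbb{Q}$-algebra by (the classes of) $x_{0,2}, x_{0,4}, \ldots, x_{0, 2\lfloor g/3 \rfloor}$ and $y$. Moreover, there are no relations between these elements in $\tilde{\mathcal{R}}^i$ for $i \leq \lfloor g/3 \rfloor$; that is, no nonzero polynomial with rational coefficients in $x_{0,2}, \ldots, x_{0,2\lfloor g/3\rfloor}, y$ that is homogeneous of degree $i \le \lfloor g/3\rfloor$ (where $x_{0,2m}$ has degree $m$ and $y$ has degree $1$) vanishes in $\tilde{\mathcal{R}}^i$.
   Context: Fix an integer $g \ge 2$. Let $(i,j)$ run through all pairs of integers such that $i \leq j+2$ and $i+j$ is even. Define $$\mathcal{A} := \mathbb{Q}\big[\{x_{i,j}\}, y\big]\big/\big\langle x_{0,0} - g,\ \{x_{i,j}\}_{i<0},\ \{x_{i,j}\}_{j<0},\ \{x_{i,j}\}_{j>2g-2}\big\rangle .$$ So $\mathcal{A}$ is a polynomial ring in $y$ and the $x_{i,j}$ with $0\le j\le 2g-2$, $0\le i\le j+2$, $i+j$ even, $(i,j)\ne(0,0)$, with the convention $x_{0,0}=g$ and $x_{i,j}=0$ if $i<0$ or $j<0$ or $j>2g-2$. It has a bigrading $\mathcal{A} = \bigoplus_{i,j}\mathcal{A}_{(i,j)}$ determined by $x_{i,j}\in\mathcal{A}_{(i,j)}$ and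 $y\in\mathcal{A}_{(0,2)}$. Define the $\mathbb{Q}$-linear operator $F$ on $\mathcal{A}$ by $$F(\alpha) := \frac12\sum_{\substack{i,j\\k,l}}\left(y\,x_{i-1,j-1}x_{k-1,l-1} - \binom{i+k-2}{i-1}x_{i+k-2,j+l}\right)\partial x_{i,j}\,\partial x_{k,l}(\alpha) + \sum_{i,j}x_{i-2,j}\,\partial x_{i,j}(\alpha),$$ where $\partial x_{i,j}$ denotes the partial derivative with respect to $x_{i,j}$ and the sums run over the indices of the variables of $\mathcal{A}$ (the first one over all ordered pairs of indices $(i,j)$, $(k,l)$). Let $\mathrm{Mon}_{(i,j)}$ be the set of monomials in the $x_{i,j}$ (excluding $x_{0,0}$ and all $x_{i,j}$ that vanish in $\mathcal{A}$) and $y$ that belong to $\mathcal{A}_{(i,j)}$, with $\mathrm{Mon}_{(0,0)}=\{1\}$. Define the quotient ring $$\tilde{\mathcal{T}} := \mathcal{A}\big/\big\langle \{F^\nu(\mathrm{Mon}_{(i,j)})\}_{i>2g,\ \nu\ge 0}\big\rangle$$ (quotient by the ideal generated by the indicated elements), with the induced bigrading $\tilde{\mathcal{T}}=\bigoplus_{i,j}\tilde{\mathcal{T}}_{(i,j)}$, and the subring $\tilde{\mathcal{R}} := \bigoplus_i\tilde{\mathcal{T}}_{(0,2i)}$, graded by $\tilde{\mathcal{R}}^i := \tilde{\mathcal{T}}_{(0,2i)}$. *)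

theory Defs
  imports
    "HOL-Library.Poly_Mapping"
    "HOL-Algebra.QuotRing"
    "HOL-Algebra.Generated_Rings"
begin

section \<open>Polynomials\<close>

text \<open>
  The polynomial ring over \<open>\<rat>\<close> in a set of variables is rendered as the monoid algebra of
  finitely supported exponent vectors: a monomial has type \<^typ>\<open>'v \<Rightarrow>\<^sub>0 nat\<close>, and
  \<^typ>\<open>('v \<Rightarrow>\<^sub>0 nat) \<Rightarrow>\<^sub>0 rat\<close> is a commutative ring under convolution.
\<close>

type_synonym 'v qpoly = "('v \<Rightarrow>\<^sub>0 nat) \<Rightarrow>\<^sub>0 rat"

definition qconst :: "rat \<Rightarrow> 'v qpoly" where
  "qconst c = Poly_Mapping.single 0 c"

definition qvar :: "'v \<Rightarrow> 'v qpoly" where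
  "qvar v = Poly_Mapping.single (Poly_Mapping.single v 1) 1"

definition polys_in :: "'v set \<Rightarrow> 'v qpoly set" where
  "polys_in V = {p. \<forall>m\<in>Poly_Mapping.keys p. Poly_Mapping.keys m \<subseteq> V}"

text \<open>
  Subtraction of exponent vectors truncates, but a monomial without \<open>v\<close> contributes
  the coefficient \<open>0\<close>.
\<close>

definition pdiff :: "'v \<Rightarrow> 'v qpoly \<Rightarrow> 'v qpoly" where
  "pdiff v p =
     (\<Sum>m\<in>Poly_Mapping.keys p.
        Poly_Mapping.single (m - Poly_Mapping.single v 1)
          (of_nat (Poly_Mapping.lookup m v) * Poly_Mapping.lookup p m))"

section \<open>The bigraded algebra \<open>\<A>\<close>\<close>

datatype xy_var = XV int int | YV

definition x_index :: "nat \<Rightarrow> (int \<times> int) set" where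
  "x_index g = {(i, j). 0 \<le> j \<and> j \<le> 2 * int g - 2 \<and> 0 \<le> i \<and> i \<le> j + 2 \<and>
                        even (i + j) \<and> (i, j) \<noteq> (0, 0)}"

definition A_vars :: "nat \<Rightarrow> xy_var set" where
  "A_vars g = insert YV ((\<lambda>(i, j). XV i j) ` x_index g)"

definition A_ring :: "nat \<Rightarrow> xy_var qpoly ring" where
  "A_ring g = \<lparr>carrier = polys_in (A_vars g), mult = (*), one = 1, zero = 0, add = (+)\<rparr>"

text \<open>
  The element \<open>x\<^bsub>i,j\<^esub>\<close> of \<open>\<A>\<close>, with the conventions \<open>x\<^bsub>0,0\<^esub> = g\<close> and \<open>x\<^bsub>i,j\<^esub> = 0\<close> for
  \<open>i < 0\<close>, \<open>j < 0\<close> or \<open>j > 2g - 2\<close>.  It is only ever used for \<open>i \<le> j + 2\<close> and \<open>i + j\<close> even; the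
  value \<open>0\<close> at other pairs is a dummy.
\<close>

definition x_elem :: "nat \<Rightarrow> int \<Rightarrow> int \<Rightarrow> xy_var qpoly" where
  "x_elem g i j =
     (if (i, j) = (0, 0) then qconst (of_nat g)
      else if (i, j) \<in> x_index g then qvar (XV i j)
      else 0)"

definition y_elem :: "xy_var qpoly" where
  "y_elem = qvar YV"

fun var_bideg :: "xy_var \<Rightarrow> int \<times> int" where
  "var_bideg (XV i j) = (i, j)"
| "var_bideg YV = (0, 2)"

definition mon_bideg :: "(xy_var \<Rightarrow>\<^sub>0 nat) \<Rightarrow> int \<times> int" where
  "mon_bideg m =
     (\<Sum>v\<in>Poly_Mapping.keys m. int (Poly_Mapping.lookup m v) * fst (var_bideg v),
      \<Sum>v\<in>Poly_Mapping.keys m. int (Poly_Mapping.lookup m v) * snd (var_bideg v))"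

definition A_comp :: "nat \<Rightarrow> int \<Rightarrow> int \<Rightarrow> xy_var qpoly set" where
  "A_comp g i j = {p \<in> carrier (A_ring g). \<forall>m\<in>Poly_Mapping.keys p. mon_bideg m = (i, j)}"

section \<open>The operator \<open>F\<close>\<close>

text \<open>
  Binomial coefficient with integer arguments, zero for a negative lower argument.  This
  convention matters: for \<open>i = 0\<close> and \<open>k \<ge> 2\<close> the coefficient
  \<open>binomial(i + k - 2, i - 1)\<close> in \<open>F\<close> multiplies a variable that need not vanish.
\<close>

definition int_binom :: "int \<Rightarrow> int \<Rightarrow> rat" where
  "int_binom n k = (if k < 0 then 0 else of_int n gchoose nat k)"

definition F_op :: "nat \<Rightarrow> xy_var qpoly \<Rightarrow> xy_var qpoly" where
  "F_op g \<alpha> =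
     qconst (1 / 2) *
       (\<Sum>(i, j)\<in>x_index g. \<Sum>(k, l)\<in>x_index g.
          (y_elem * x_elem g (i - 1) (j - 1) * x_elem g (k - 1) (l - 1)
             - qconst (int_binom (i + k - 2) (i - 1)) * x_elem g (i + k - 2) (j + l))
          * pdiff (XV i j) (pdiff (XV k l) \<alpha>))
     + (\<Sum>(i, j)\<in>x_index g. x_elem g (i - 2) j * pdiff (XV i j) \<alpha>)"

section \<open>The quotient \<open>\<T>\<close> and its subring \<open>\<R>\<close>\<close>

definition Mon :: "nat \<Rightarrow> int \<Rightarrow> int \<Rightarrow> xy_var qpoly set" where
  "Mon g i j = {Poly_Mapping.single m 1 | m. Poly_Mapping.keys m \<subseteq> A_vars g \<and> mon_bideg m = (i, j)}"

definition T_relations :: "nat \<Rightarrow> xy_var qpoly set" where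
  "T_relations g = {(F_op g ^^ \<nu>) q | \<nu> i j q. i > 2 * int g \<and> q \<in> Mon g i j}"

definition T_ideal :: "nat \<Rightarrow> xy_var qpoly set" where
  "T_ideal g = Idl\<^bsub>A_ring g\<^esub> (T_relations g)"

definition T_ring :: "nat \<Rightarrow> xy_var qpoly set ring" where
  "T_ring g = A_ring g Quot T_ideal g"

definition T_class :: "nat \<Rightarrow> xy_var qpoly \<Rightarrow> xy_var qpoly set" where
  "T_class g p = T_ideal g +>\<^bsub>A_ring g\<^esub> p"

definition T_comp :: "nat \<Rightarrow> int \<Rightarrow> int \<Rightarrow> xy_var qpoly set set" where
  "T_comp g i j = T_class g ` A_comp g i j"

text \<open>
  The components \<open>\<T>\<^bsub>(0,2i)\<^esub>\<close> with \<open>i < 0\<close> vanish, so the sum ranges over natural numbers.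
\<close>

definition R_comp :: "nat \<Rightarrow> nat \<Rightarrow> xy_var qpoly set set" where
  "R_comp g i = T_comp g 0 (2 * int i)"

definition R_ring :: "nat \<Rightarrow> xy_var qpoly set ring" where
  "R_ring g = (T_ring g)\<lparr>carrier :=
     {\<Oplus>\<^bsub>T_ring g\<^esub>i\<in>{..n}. t i | n t. \<forall>i. t i \<in> R_comp g i}\<rparr>"

text \<open>
  The \<open>\<rat>\<close>-subalgebra generated by a set is the subring generated by that set
  together with the scalars, i.e. the classes of the rational constants.
\<close>

definition R_scalars :: "nat \<Rightarrow> xy_var qpoly set set" where
  "R_scalars g = range (\<lambda>c. T_class g (qconst c))"

definition R_generated :: "nat \<Rightarrow> xy_var qpoly set set \<Rightarrow> xy_var qpoly set set" where
  "R_generated g S = generate_ring (R_ring g) (R_scalars g \<union> S)"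

text \<open>
  The variables \<open>x\<^bsub>0,2\<^esub>, x\<^bsub>0,4\<^esub>, \<dots>, x\<^bsub>0,2\<lfloor>g/3\<rfloor>\<^esub>\<close> and \<open>y\<close>.  They are distinct variables of \<open>\<A>\<close>, so a
  polynomial in them is an element of \<open>\<A>\<close>, and its value in \<open>\<T>\<close> is its class.
\<close>

definition gen_vars :: "nat \<Rightarrow> xy_var set" where
  "gen_vars g = insert YV ((\<lambda>m. XV 0 (2 * int m)) ` {1..g div 3})"

text \<open>
  Weighted degree in which \<open>x\<^bsub>0,2m\<^esub>\<close> has degree \<open>m\<close> and \<open>y\<close> has degree \<open>1\<close>.
\<close>

definition gen_polys_of_degree :: "nat \<Rightarrow> nat \<Rightarrow> xy_var qpoly set" where
  "gen_polys_of_degree g i = polys_in (gen_vars g) \<inter> A_comp g 0 (2 * int i)"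

end

theory Submission
  imports Defs
begin

text \<open>
  On \<open>\<A>\<^bsub>(i,j)\<^esub>\<close> one has \<open>F x\<^bsub>2,0\<^esub> = x\<^bsub>2,0\<^esub> F + (g - i)\<close>, so for \<open>p\<close> of first degree
  \<open>2n - 2\<close> one gets \<open>F\<^sup>n(x\<^bsub>2,0\<^esub> p) = n (g + 1 - n) F\<^sup>n\<^sup>-\<^sup>1(p)\<close>.
  Every other variable satisfies \<open>i \<le> 3 j\<close>.  Hence a monomial of bidegree \<open>(2n, j)\<close> with
  \<open>n > g\<close> and \<open>3 j \<le> 2 g\<close> contains enough factors \<open>x\<^bsub>2,0\<^esub>\<close> to meet the vanishing coefficient
  at \<open>n = g + 1\<close>, and gives no relation in bidegree \<open>(0, j)\<close>.

  For \<open>g/3 < j < g\<close> the relation \<open>F\<^sup>3\<^sup>j(x\<^bsub>3,1\<^esub>\<^sup>2\<^sup>j)\<close> expresses \<open>x\<^bsub>0,2j\<^esub>\<close> through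
  \<open>y\<close> and the \<open>x\<^bsub>0,2l\<^esub>\<close> with \<open>l < j\<close>: modulo \<open>y\<close> all contributions to the coefficient of
  \<open>x\<^bsub>0,2j\<^esub>\<close> have the same sign, and one of them comes from merging the factors successively into
  \<open>x\<^bsub>2j+2,2j\<^esub>\<close> and then shifting down to \<open>x\<^bsub>0,2j\<^esub>\<close>.
\<close>

abbreviation keys where "keys \<equiv> Poly_Mapping.keys"
abbreviation lookup where "lookup \<equiv> Poly_Mapping.lookup"
abbreviation single where "single \<equiv> Poly_Mapping.single"

section \<open>Monomials and polynomials\<close>

definition evar :: "'v \<Rightarrow> 'v \<Rightarrow>\<^sub>0 nat" where
  "evar v = single v 1"

lemma lookup_evar: "lookup (evar v) w = (if v = w then 1 else 0)"
  by (simp add: evar_def lookup_single when_def)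

lemma keys_evar [simp]: "keys (evar v) = {v}"
  by (simp add: evar_def)

lemma keys_plus_nat: "keys (m + n) = keys m \<union> keys n" for m n :: "'v \<Rightarrow>\<^sub>0 nat"
  by (auto simp: in_keys_iff lookup_add)

lemma evar_diff: "lookup m v \<noteq> 0 \<Longrightarrow> evar v + (m - evar v) = m"
  by (rule poly_mapping_eqI) (auto simp: lookup_add lookup_minus lookup_evar)

lemma keys_diff_nat: "keys (m - n) \<subseteq> keys m" for m n :: "'v \<Rightarrow>\<^sub>0 nat"
  by (auto simp: in_keys_iff lookup_minus)

lemma poly_eq_sum_single: "p = (\<Sum>m\<in>keys p. single m (lookup p m))"
proof (rule poly_mapping_eqI)
  fix k
  show "lookup p k = lookup (\<Sum>m\<in>keys p. single m (lookup p m)) k"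
    by (simp add: lookup_sum lookup_single when_def in_keys_iff)
qed

lemma keys_add_subset: "keys p \<subseteq> S \<Longrightarrow> keys q \<subseteq> S \<Longrightarrow> keys (p + q) \<subseteq> S"
  using Poly_Mapping.keys_add[of p q] by auto

lemma keys_sum_subset: "(\<And>a. a \<in> A \<Longrightarrow> keys (f a) \<subseteq> S) \<Longrightarrow> keys (sum f A) \<subseteq> S"
  by (induction A rule: infinite_finite_induct) (simp_all add: keys_add_subset)

lemma keys_mult_subset:
  assumes "keys p \<subseteq> S" "keys q \<subseteq> T" "\<And>a b. a \<in> S \<Longrightarrow> b \<in> T \<Longrightarrow> a + b \<in> U"
  shows "keys (p * q) \<subseteq> U"
proof
  fix m assume "m \<in> keys (p * q)"
  then obtain a b where "m = a + b" "a \<in> keys p" "b \<in> keys q"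
    using keys_mult[of p q] by auto
  then show "m \<in> U"
    using assms by auto
qed

lemma keys_uminus_subset: "keys p \<subseteq> S \<Longrightarrow> keys (- p :: 'a \<Rightarrow>\<^sub>0 rat) \<subseteq> S"
  by (auto simp: in_keys_iff)

lemma keys_qconst: "keys (qconst c) \<subseteq> {0}"
  by (simp add: qconst_def)

lemma qconst_mult: "qconst c * qconst d = qconst (c * d)"
  by (simp add: qconst_def mult_single)

lemma qconst_add: "qconst c + qconst d = qconst (c + d)"
  by (simp add: qconst_def single_add)

lemma qconst_diff: "qconst c - qconst d = qconst (c - d)"
  by (simp add: qconst_def single_diff)

lemma qconst_0 [simp]: "qconst 0 = 0"
  by (simp add: qconst_def)

lemma qconst_1 [simp]: "qconst 1 = 1"
  by (simp add: qconst_def)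

lemma qconst_single: "qconst c * single m d = single m (c * d)"
  by (simp add: qconst_def mult_single)

lemma qvar_evar: "qvar v = single (evar v) 1"
  by (simp add: qvar_def evar_def)

section \<open>Additive weights of monomials and the bidegree\<close>

lemma wt_superset:
  assumes "finite V" "keys m \<subseteq> V"
  shows "(\<Sum>v\<in>keys m. of_nat (lookup m v) * f v)
    = (\<Sum>v\<in>V. of_nat (lookup m v) * (f v :: 'a :: comm_semiring_1))"
  by (rule sum.mono_neutral_left) (use assms in \<open>auto simp: in_keys_iff\<close>)

text \<open>Both supports are enlarged to their union. Taking for \<open>f\<close> a component of
  \<open>var_bideg\<close> gives the bidegree, and the constant 1 gives the total degree, which
  serves for signs and for induction on monomials.\<close>

lemma wt_add:
  "(\<Sum>v\<in>keys (m + n). of_nat (lookup (m + n) v) * f v)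
    = (\<Sum>v\<in>keys m. of_nat (lookup m v) * f v)
      + (\<Sum>v\<in>keys n. of_nat (lookup n v) * (f v :: 'a :: comm_semiring_1))"
  using wt_superset[of "keys m \<union> keys n" "m + n" f] wt_superset[of "keys m \<union> keys n" m f]
    wt_superset[of "keys m \<union> keys n" n f]
  by (simp add: keys_plus_nat lookup_add sum.distrib distrib_right)

lemma mon_bideg_add:
  "mon_bideg (m + n) =
    (fst (mon_bideg m) + fst (mon_bideg n), snd (mon_bideg m) + snd (mon_bideg n))"
  unfolding mon_bideg_def by (simp add: wt_add)

lemma mon_bideg_evar [simp]: "mon_bideg (evar v) = var_bideg v"
  by (simp add: mon_bideg_def lookup_evar)

lemma mon_bideg_0 [simp]: "mon_bideg 0 = (0, 0)"
  by (simp add: mon_bideg_def)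

section \<open>Partial derivatives\<close>

text \<open>Cancellation may make the support of a sum smaller than the union of the supports. Over
  a common finite index set \<open>M\<close> additivity becomes termwise.\<close>

lemma pdiff_superset:
  assumes "finite M" "keys p \<subseteq> M"
  shows "pdiff v p = (\<Sum>m\<in>M. single (m - evar v) (of_nat (lookup m v) * lookup p m))"
  unfolding pdiff_def evar_def
  by (rule sum.mono_neutral_left) (use assms in \<open>auto simp: in_keys_iff\<close>)

lemma pdiff_add: "pdiff v (p + q) = pdiff v p + pdiff v q"
proof -
  have "keys (p + q) \<subseteq> keys p \<union> keys q"
    by (rule Poly_Mapping.keys_add)
  then show ?thesis
    by (subst (1 2 3) pdiff_superset[of "keys p \<union> keys q"])
      (auto simp: lookup_add algebra_simps single_add sum.distrib)
qed

lemma pdiff_single: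
  "pdiff v (single m c) = single (m - evar v) (of_nat (lookup m v) * c)"
  by (subst pdiff_superset[of "{m}"]) auto

lemma pdiff_0 [simp]: "pdiff v 0 = 0"
  by (simp add: pdiff_def)

lemma pdiff_sum: "pdiff v (sum f A) = (\<Sum>a\<in>A. pdiff v (f a))"
  by (induction A rule: infinite_finite_induct) (auto simp: pdiff_add)

lemma keys_pdiff_subset:
  assumes "keys p \<subseteq> S" "\<And>m. m \<in> S \<Longrightarrow> lookup m v \<noteq> 0 \<Longrightarrow> m - evar v \<in> T"
  shows "keys (pdiff v p) \<subseteq> T"
  unfolding pdiff_def evar_def[symmetric]
  by (rule keys_sum_subset) (use assms in auto)

lemma pdiff_qvar_mult:
  "pdiff v (qvar w * p) = qvar w * pdiff v p + (if v = w then p else 0)"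
proof -
  have *: "pdiff v (qvar w * single m c)
      = qvar w * pdiff v (single m c) + (if v = w then single m c else 0)" for m c
  proof (cases "v = w")
    case False
    then have "evar w + m - evar v = evar w + (m - evar v)"
      by (intro poly_mapping_eqI) (auto simp: lookup_add lookup_minus lookup_evar)
    then show ?thesis
      using False by (simp add: qvar_evar mult_single pdiff_single lookup_add lookup_evar)
  next
    case True
    show ?thesis
    \<comment> \<open>If \<open>v\<close> does not divide \<open>m\<close>, the truncated
      \<open>m - evar v\<close> carries the coefficient 0. Otherwise \<open>evar_diff\<close>
      restores \<open>m\<close>, and the exponent grows by one, which yields the extra
      summand.\<close>
    proof (cases "lookup m v = 0")
      case True
      then show ?thesis
        using \<open>v = w\<close> by (simp add: qvar_evar mult_single pdiff_single lookup_add lookup_evar)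
    next
      case False
      have "evar v + m - evar v = m"
        by simp
      then show ?thesis
        using \<open>v = w\<close> False evar_diff[OF False]
        by (simp add: qvar_evar mult_single pdiff_single lookup_add lookup_evar algebra_simps
            single_add)
    qed
  qed
  have "pdiff v (qvar w * p) = (\<Sum>m\<in>keys p. pdiff v (qvar w * single m (lookup p m)))"
    by (subst poly_eq_sum_single[of p]) (simp only: sum_distrib_left pdiff_sum)
  also have "\<dots> = qvar w * pdiff v (\<Sum>m\<in>keys p. single m (lookup p m))
      + (if v = w then (\<Sum>m\<in>keys p. single m (lookup p m)) else 0)"
    by (simp add: * sum.distrib pdiff_sum sum_distrib_left)
  finally show ?thesis
    by (simp flip: poly_eq_sum_single)
qed

section \<open>The bigrading\<close>

lemma finite_x_index [simp]: "finite (x_index g)"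
  by (rule finite_subset[of _ "{0..2 * int g} \<times> {0..2 * int g}"]) (auto simp: x_index_def)

lemma finite_A_vars [simp]: "finite (A_vars g)"
  by (simp add: A_vars_def)

lemma A_comp_iff:
  "p \<in> A_comp g i j \<longleftrightarrow> keys p \<subseteq> {m. keys m \<subseteq> A_vars g \<and> mon_bideg m = (i, j)}"
  by (auto simp: A_comp_def A_ring_def polys_in_def)

lemma A_comp_0 [simp]: "0 \<in> A_comp g i j"
  by (simp add: A_comp_iff)

lemma A_comp_add: "p \<in> A_comp g i j \<Longrightarrow> q \<in> A_comp g i j \<Longrightarrow> p + q \<in> A_comp g i j"
  by (simp add: A_comp_iff keys_add_subset)

lemma A_comp_diff: "p \<in> A_comp g i j \<Longrightarrow> q \<in> A_comp g i j \<Longrightarrow> p - q \<in> A_comp g i j"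
  using A_comp_add[of p g i j "- q"] keys_uminus_subset[of q]
  by (simp add: A_comp_iff)

lemma A_comp_sum: "(\<And>a. a \<in> A \<Longrightarrow> f a \<in> A_comp g i j) \<Longrightarrow> sum f A \<in> A_comp g i j"
  by (simp add: A_comp_iff keys_sum_subset)

lemma A_comp_mult:
  assumes "p \<in> A_comp g a b" "q \<in> A_comp g c d" "i = a + c" "j = b + d"
  shows "p * q \<in> A_comp g i j"
  using assms unfolding A_comp_iff
  by (elim keys_mult_subset) (auto simp: keys_plus_nat mon_bideg_add)

lemma A_comp_qconst: "qconst c \<in> A_comp g 0 0"
  using keys_qconst[of c] by (auto simp: A_comp_iff)

lemma A_comp_qconst_mult: "p \<in> A_comp g i j \<Longrightarrow> qconst c * p \<in> A_comp g i j"
  by (rule A_comp_mult[OF A_comp_qconst]) auto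

lemma A_comp_x_elem: "x_elem g i j \<in> A_comp g i j"
proof -
  have "qvar (XV i j) \<in> A_comp g i j" if "(i, j) \<in> x_index g"
    using that by (auto simp: A_comp_iff qvar_evar A_vars_def)
  then show ?thesis
    using A_comp_qconst by (auto simp: x_elem_def)
qed

lemma A_comp_y_elem: "y_elem \<in> A_comp g 0 2"
  by (simp add: A_comp_iff y_elem_def qvar_evar A_vars_def)

lemma A_comp_pdiff:
  assumes "p \<in> A_comp g a b" "i = a - k" "j = b - l"
  shows "pdiff (XV k l) p \<in> A_comp g i j"
  unfolding A_comp_iff
proof (rule keys_pdiff_subset)
  show "keys p \<subseteq> {m. keys m \<subseteq> A_vars g \<and> mon_bideg m = (a, b)}"
    using assms by (simp add: A_comp_iff)
next
  fix m assume m: "m \<in> {m. keys m \<subseteq> A_vars g \<and> mon_bideg m = (a, b)}"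
    "lookup m (XV k l) \<noteq> 0"
  from evar_diff[OF m(2)] have "mon_bideg m = mon_bideg (evar (XV k l) + (m - evar (XV k l)))"
    by simp
  then have "mon_bideg (m - evar (XV k l)) = (i, j)"
    using m assms by (cases "mon_bideg (m - evar (XV k l))") (auto simp: mon_bideg_add)
  then show "m - evar (XV k l) \<in> {m. keys m \<subseteq> A_vars g \<and> mon_bideg m = (i, j)}"
    using m(1) keys_diff_nat[of m "evar (XV k l)"] by auto
qed

text \<open>Summing over the fixed set \<open>x_index g\<close>, with the share of \<open>YV\<close>
  split off, allows estimates index by index. \<open>YV\<close> contributes to the second degree
  only.\<close>

lemma mon_bideg_expand:
  assumes "keys m \<subseteq> A_vars g"
  shows "fst (mon_bideg m) = (\<Sum>(k, l)\<in>x_index g. int (lookup m (XV k l)) * k)"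
    and "snd (mon_bideg m) = 2 * int (lookup m YV) + (\<Sum>(k, l)\<in>x_index g. int (lookup m (XV k l)) * l)"
proof -
  have inj: "inj_on (\<lambda>(i, j). XV i j) (x_index g)"
    by (auto simp: inj_on_def)
  have YV: "YV \<notin> (\<lambda>(i, j). XV i j) ` x_index g"
    by auto
  have *: "(\<Sum>v\<in>keys m. int (lookup m v) * f v)
      = int (lookup m YV) * f YV + (\<Sum>(k, l)\<in>x_index g. int (lookup m (XV k l)) * f (XV k l))" for f
    unfolding wt_superset[OF finite_A_vars assms] A_vars_def
    by (simp only: sum.insert[OF finite_imageI[OF finite_x_index] YV] sum.reindex[OF inj] o_def)
      (simp add: split_beta)
  show "fst (mon_bideg m) = (\<Sum>(k, l)\<in>x_index g. int (lookup m (XV k l)) * k)"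
    and "snd (mon_bideg m) = 2 * int (lookup m YV) + (\<Sum>(k, l)\<in>x_index g. int (lookup m (XV k l)) * l)"
    unfolding mon_bideg_def by (simp_all add: *)
qed

lemma mon_bideg_nonneg:
  assumes "keys m \<subseteq> A_vars g"
  shows "fst (mon_bideg m) \<ge> 0" "snd (mon_bideg m) \<ge> 0"
  unfolding mon_bideg_expand[OF assms]
  by (auto intro!: sum_nonneg add_nonneg_nonneg simp: x_index_def)

text \<open>No variable has negative first degree. Since \<open>F_op\<close> lowers the first degree
  by 2, high powers of it therefore annihilate a homogeneous element.\<close>

lemma A_comp_neg: "i < 0 \<Longrightarrow> p \<in> A_comp g i j \<Longrightarrow> p = 0"
  by (rule ccontr) (use mon_bideg_nonneg(1)[of _ g] in \<open>force simp: A_comp_iff simp flip: keys_eq_empty\<close>)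

text \<open>Euler's identity for the first grading: differentiating by \<open>XV k l\<close> and
  multiplying back multiplies a monomial by its exponent of \<open>XV k l\<close>. It evaluates the
  commutator of \<open>F_op\<close> with multiplication by \<open>XV 2 0\<close>.\<close>

lemma euler:
  assumes "p \<in> A_comp g i j"
  shows "(\<Sum>(k, l)\<in>x_index g. qconst (of_int k) * x_elem g k l * pdiff (XV k l) p)
    = qconst (of_int i) * p"
proof -
  have *: "qconst (of_int k) * x_elem g k l * pdiff (XV k l) (single m c)
      = single m (of_int (int (lookup m (XV k l)) * k) * c)" if "(k, l) \<in> x_index g" for k l m c
  proof (cases "lookup m (XV k l) = 0")
    case True
    then show ?thesis by (simp add: pdiff_single)
  next
    case False
    have "x_elem g k l = single (evar (XV k l)) 1"
      using that by (auto simp: x_elem_def x_index_def qvar_evar)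
    then show ?thesis
      by (simp add: pdiff_single mult_single evar_diff[OF False] mult.assoc qconst_single mult_ac)
  qed
  have sgl: "single m (sum f A) = (\<Sum>a\<in>A. single m (f a :: rat))" for m f A
    by (induction A rule: infinite_finite_induct) (auto simp: single_add)
  have "(\<Sum>(k, l)\<in>x_index g. qconst (of_int k) * x_elem g k l * pdiff (XV k l) p)
    = (\<Sum>(k, l)\<in>x_index g. \<Sum>m\<in>keys p.
        qconst (of_int k) * x_elem g k l * pdiff (XV k l) (single m (lookup p m)))"
    by (subst poly_eq_sum_single[of p]) (simp only: pdiff_sum sum_distrib_left)
  also have "\<dots> = (\<Sum>m\<in>keys p. \<Sum>(k, l)\<in>x_index g.
        qconst (of_int k) * x_elem g k l * pdiff (XV k l) (single m (lookup p m)))"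
    unfolding split_beta by (rule sum.swap)
  also have "\<dots> = (\<Sum>m\<in>keys p. \<Sum>(k, l)\<in>x_index g.
        single m (of_int (int (lookup m (XV k l)) * k) * lookup p m))"
    by (intro sum.cong refl) (auto simp: *)
  also have "\<dots> = (\<Sum>m\<in>keys p. single m (of_int i * lookup p m))"
  proof (intro sum.cong refl)
    fix m assume "m \<in> keys p"
    then have m: "keys m \<subseteq> A_vars g" and bi: "mon_bideg m = (i, j)"
      using assms by (auto simp: A_comp_iff)
    have "of_int i = (\<Sum>(k, l)\<in>x_index g. of_int (int (lookup m (XV k l)) * k) :: rat)"
      using mon_bideg_expand(1)[OF m] bi by (simp add: split_beta)
    then show "(\<Sum>(k, l)\<in>x_index g. single m (of_int (int (lookup m (XV k l)) * k) * lookup p m))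
        = single m (of_int i * lookup p m)"
      by (simp add: sgl sum_distrib_right split_beta)
  qed
  also have "\<dots> = qconst (of_int i) * (\<Sum>m\<in>keys p. single m (lookup p m))"
    by (simp add: sum_distrib_left qconst_single)
  finally show ?thesis
    by (simp flip: poly_eq_sum_single)
qed

section \<open>The operator \<open>F\<close> and multiplication by \<open>x\<^bsub>2,0\<^esub>\<close>\<close>

text \<open>The first summand is divisible by \<open>y_elem\<close>; the second merges the variables
  indexed by \<open>v\<close> and \<open>w\<close> into a single one.\<close>

definition F_coeff :: "nat \<Rightarrow> int \<times> int \<Rightarrow> int \<times> int \<Rightarrow> xy_var qpoly" where
  "F_coeff g v w =
     y_elem * x_elem g (fst v - 1) (snd v - 1) * x_elem g (fst w - 1) (snd w - 1)
     - qconst (int_binom (fst v + fst w - 2) (fst v - 1)) * x_elem g (fst v + fst w - 2) (snd v + snd w)"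

definition xdiff :: "int \<times> int \<Rightarrow> xy_var qpoly \<Rightarrow> xy_var qpoly" where
  "xdiff v = pdiff (XV (fst v) (snd v))"

lemma F_op_alt:
  "F_op g p = qconst (1 / 2) *
      (\<Sum>v\<in>x_index g. \<Sum>w\<in>x_index g. F_coeff g v w * xdiff v (xdiff w p))
    + (\<Sum>v\<in>x_index g. x_elem g (fst v - 2) (snd v) * xdiff v p)"
  by (simp add: F_op_def F_coeff_def xdiff_def split_beta)

lemma F_op_add: "F_op g (p + q) = F_op g p + F_op g q"
  by (simp add: F_op_alt xdiff_def pdiff_add distrib_left sum.distrib)

lemma F_op_0 [simp]: "F_op g 0 = 0"
  by (simp add: F_op_alt xdiff_def)

lemma F_op_sum: "F_op g (sum f A) = (\<Sum>a\<in>A. F_op g (f a))"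
  by (induction A rule: infinite_finite_induct) (auto simp: F_op_add)

lemma pdiff_qconst_mult: "pdiff v (qconst c * p) = qconst c * pdiff v p"
proof -
  have "pdiff v (qconst c * p) = (\<Sum>m\<in>keys p. pdiff v (qconst c * single m (lookup p m)))"
    by (subst poly_eq_sum_single[of p]) (simp only: sum_distrib_left pdiff_sum)
  also have "\<dots> = qconst c * pdiff v (\<Sum>m\<in>keys p. single m (lookup p m))"
    by (simp add: pdiff_sum sum_distrib_left qconst_single pdiff_single mult_ac)
  finally show ?thesis
    by (simp flip: poly_eq_sum_single)
qed

lemma F_op_qconst_mult: "F_op g (qconst c * p) = qconst c * F_op g p"
  unfolding F_op_alt xdiff_def pdiff_qconst_mult distrib_left sum_distrib_left
  by (simp only: mult_ac)

lemma A_comp_F_coeff: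
  "F_coeff g v w \<in> A_comp g (fst v + fst w - 2) (snd v + snd w)"
  unfolding F_coeff_def
  by (intro A_comp_diff A_comp_qconst_mult A_comp_x_elem
      A_comp_mult[OF A_comp_mult[OF A_comp_y_elem A_comp_x_elem refl refl] A_comp_x_elem]) auto

lemma A_comp_xdiff: "p \<in> A_comp g i j \<Longrightarrow> xdiff v p \<in> A_comp g (i - fst v) (j - snd v)"
  unfolding xdiff_def by (rule A_comp_pdiff) auto

text \<open>Each term removes one or two variables and puts back a coefficient whose first degree is
  lower by 2 and whose second degree is the same.\<close>

lemma A_comp_F_op:
  assumes "p \<in> A_comp g i j"
  shows "F_op g p \<in> A_comp g (i - 2) j"
  unfolding F_op_alt
  by (intro A_comp_add A_comp_qconst_mult A_comp_sum
      A_comp_mult[OF A_comp_F_coeff A_comp_xdiff[OF A_comp_xdiff[OF assms]]]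
      A_comp_mult[OF A_comp_x_elem A_comp_xdiff[OF assms]]) auto

lemma A_comp_F_op_pow:
  "p \<in> A_comp g i j \<Longrightarrow> (F_op g ^^ n) p \<in> A_comp g (i - 2 * int n) j"
proof (induction n)
  case (Suc n)
  then show ?case
    using A_comp_F_op[of "(F_op g ^^ n) p" g "i - 2 * int n" j] by (simp add: algebra_simps)
qed auto

section \<open>Commutation of \<open>F\<close> with multiplication by \<open>XV 2 0\<close>\<close>

lemma gbinomial_nat_pred: "(of_nat (Suc n) :: rat) gchoose n = of_nat (Suc n)"
  using binomial_gbinomial[of "Suc n" n, where ?'a = rat] by simp

text \<open>The part with \<open>y_elem\<close> contains \<open>x_elem g 1 (-1) = 0\<close>, and the
  binomial coefficient with lower argument 1 is the first index of \<open>w\<close>. This is the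
  negative of the Euler coefficient.\<close>

lemma F_coeff_20_left:
  assumes "w \<in> x_index g"
  shows "F_coeff g (2, 0) w = - (qconst (of_int (fst w)) * x_elem g (fst w) (snd w))"
proof -
  have "x_elem g 1 (-1) = 0"
    by (simp add: x_elem_def x_index_def)
  moreover have "int_binom (fst w) 1 = of_int (fst w)"
    by (simp add: int_binom_def)
  ultimately show ?thesis
    by (simp add: F_coeff_def)
qed

lemma F_coeff_20_right:
  assumes "w \<in> x_index g"
  shows "F_coeff g w (2, 0) = - (qconst (of_int (fst w)) * x_elem g (fst w) (snd w))"
proof -
  have "x_elem g 1 (-1) = 0"
    by (simp add: x_elem_def x_index_def)
  moreover have "int_binom (fst w) (fst w - 1) = of_int (fst w)"
  \<comment> \<open>For first index 0 the lower argument is -1, and the convention of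
    \<open>int_binom\<close> gives the required 0.\<close>
  proof (cases "fst w = 0")
    case False
    then have "fst w \<ge> 1"
      using assms by (auto simp: x_index_def)
    then obtain n where "fst w = int (Suc n)"
      by (metis One_nat_def int_ops(2) nat_le_iff_add le_nat_iff of_nat_0_le_iff order_trans
          plus_1_eq_Suc zero_le_one int_nat_eq nat_int of_nat_le_iff)
    then show ?thesis
      using gbinomial_nat_pred[of n] by (simp add: int_binom_def)
  qed (simp add: int_binom_def)
  ultimately show ?thesis
    by (simp add: F_coeff_def)
qed

text \<open>By the Leibniz rule the commutator consists of the terms in which a derivative hits the
  new factor. The second-order part gives twice minus the Euler sum, halved by the factor 1/2; the
  first-order part gives \<open>x_elem g 0 0\<close>, the constant \<open>g\<close>.\<close>

lemma F_op_x20_mult: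
  assumes "g \<ge> 1" "p \<in> A_comp g i j"
  shows "F_op g (qvar (XV 2 0) * p)
    = qvar (XV 2 0) * F_op g p + qconst (of_nat g - of_int i) * p"
proof -
  let ?e = "qvar (XV 2 0)" and ?X = "x_index g"
  let ?E = "\<Sum>v\<in>?X. qconst (of_int (fst v)) * x_elem g (fst v) (snd v) * xdiff v p"
  have E: "(2, 0) \<in> ?X"
    using assms(1) by (simp add: x_index_def)
  have eul: "?E = qconst (of_int i) * p"
    using euler[OF assms(2)] by (simp add: xdiff_def split_beta)
  have D: "xdiff v (?e * q) = ?e * xdiff v q + (if v = (2, 0) then q else 0)" for v q
    by (cases v) (simp add: xdiff_def pdiff_qvar_mult)
  have D0: "xdiff v (if b then q else 0) = (if b then xdiff v q else 0)" for v b q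
    by (simp add: xdiff_def)
  have Dadd: "xdiff v (a + b) = xdiff v a + xdiff v b" for v a b
    by (simp add: xdiff_def pdiff_add)
  have DD: "F_coeff g v w * xdiff v (xdiff w (?e * p)) = ?e * (F_coeff g v w * xdiff v (xdiff w p))
      + (if v = (2, 0) then F_coeff g v w * xdiff w p else 0)
      + (if w = (2, 0) then F_coeff g v w * xdiff v p else 0)" for v w
    by (simp add: D Dadd D0) (simp add: algebra_simps)
  have "(\<Sum>v\<in>?X. \<Sum>w\<in>?X. F_coeff g v w * xdiff v (xdiff w (?e * p)))
      = ?e * (\<Sum>v\<in>?X. \<Sum>w\<in>?X. F_coeff g v w * xdiff v (xdiff w p))
       + (\<Sum>v\<in>?X. \<Sum>w\<in>?X. if v = (2, 0) then F_coeff g v w * xdiff w p else 0)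
       + (\<Sum>v\<in>?X. \<Sum>w\<in>?X. if w = (2, 0) then F_coeff g v w * xdiff v p else 0)"
    by (simp only: DD sum.distrib sum_distrib_left)
  \<comment> \<open>The outer derivative hits the factor \<open>XV 2 0\<close> here, the inner one
    in the next sum; both sums equal \<open>- ?E\<close>.\<close>
  also have "(\<Sum>v\<in>?X. \<Sum>w\<in>?X. if v = (2, 0) then F_coeff g v w * xdiff w p else 0)
      = (\<Sum>w\<in>?X. F_coeff g (2, 0) w * xdiff w p)"
    by (subst sum.swap) (simp add: E)
  also have "(\<Sum>w\<in>?X. F_coeff g (2, 0) w * xdiff w p) = - ?E"
    by (simp add: F_coeff_20_left sum_negf)
  also have "(\<Sum>v\<in>?X. \<Sum>w\<in>?X. if w = (2, 0) then F_coeff g v w * xdiff v p else 0)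
      = (\<Sum>v\<in>?X. F_coeff g v (2, 0) * xdiff v p)"
    by (simp add: E)
  also have "(\<Sum>v\<in>?X. F_coeff g v (2, 0) * xdiff v p) = - ?E"
    by (simp add: F_coeff_20_right sum_negf)
  finally have S2: "(\<Sum>v\<in>?X. \<Sum>w\<in>?X. F_coeff g v w * xdiff v (xdiff w (?e * p)))
      = ?e * (\<Sum>v\<in>?X. \<Sum>w\<in>?X. F_coeff g v w * xdiff v (xdiff w p))
        - qconst (of_int i) * p - qconst (of_int i) * p"
    unfolding eul by simp
  have DS: "x_elem g (fst v - 2) (snd v) * xdiff v (?e * p)
      = ?e * (x_elem g (fst v - 2) (snd v) * xdiff v p)
        + (if v = (2, 0) then x_elem g (fst v - 2) (snd v) * p else 0)" for v
    by (simp add: D) (simp add: algebra_simps)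
  have "(\<Sum>v\<in>?X. x_elem g (fst v - 2) (snd v) * xdiff v (?e * p))
      = ?e * (\<Sum>v\<in>?X. x_elem g (fst v - 2) (snd v) * xdiff v p)
        + (\<Sum>v\<in>?X. if v = (2, 0) then x_elem g (fst v - 2) (snd v) * p else 0)"
    by (simp only: DS sum.distrib sum_distrib_left)
  also have "(\<Sum>v\<in>?X. if v = (2, 0) then x_elem g (fst v - 2) (snd v) * p else 0)
      = qconst (of_nat g) * p"
    by (simp add: E x_elem_def)
  finally have S1: "(\<Sum>v\<in>?X. x_elem g (fst v - 2) (snd v) * xdiff v (?e * p))
      = ?e * (\<Sum>v\<in>?X. x_elem g (fst v - 2) (snd v) * xdiff v p) + qconst (of_nat g) * p" .
  have half: "qconst (1 / 2) * (a - qconst c * p - qconst c * p) = qconst (1 / 2) * a - qconst c * p"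
    for a c
  proof -
    have "qconst (1 / 2) * (qconst c * p) + qconst (1 / 2) * (qconst c * p) = qconst c * p"
      unfolding mult.assoc[symmetric] qconst_mult distrib_right[symmetric] qconst_add by simp
    then show ?thesis
      by (simp add: algebra_simps)
  qed
  show ?thesis
    unfolding F_op_alt[of g "?e * p"] F_op_alt[of g p] S1 S2 half
    by (simp add: algebra_simps flip: qconst_diff)
qed

text \<open>Iterating the commutator adds up \<open>g - i + 2 * k\<close> for \<open>k\<close> from
  0 to \<open>n\<close>, because each application lowers the first degree by 2. The sum is
  \<open>(n + 1) * (g - i + n)\<close>.\<close>

lemma F_op_pow_x20_mult:
  assumes "g \<ge> 1" "p \<in> A_comp g i j"
  shows "(F_op g ^^ Suc n) (qvar (XV 2 0) * p)
    = qvar (XV 2 0) * (F_op g ^^ Suc n) p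
      + qconst (of_nat (Suc n) * (of_nat g - of_int i + of_nat n)) * (F_op g ^^ n) p"
proof (induction n)
  case 0
  show ?case
    using F_op_x20_mult[OF assms] by simp
next
  case (Suc n)
  let ?q = "(F_op g ^^ Suc n) p"
  have q: "?q \<in> A_comp g (i - 2 * int (Suc n)) j"
    by (rule A_comp_F_op_pow[OF assms(2)])
  have "(F_op g ^^ Suc (Suc n)) (qvar (XV 2 0) * p)
      = F_op g (qvar (XV 2 0) * ?q)
        + F_op g (qconst (of_nat (Suc n) * (of_nat g - of_int i + of_nat n)) * (F_op g ^^ n) p)"
    using Suc by (simp add: F_op_add)
  also have "\<dots> = qvar (XV 2 0) * F_op g ?q
      + (qconst (of_nat g - of_int (i - 2 * int (Suc n)))
         + qconst (of_nat (Suc n) * (of_nat g - of_int i + of_nat n))) * ?q"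
    unfolding F_op_x20_mult[OF assms(1) q] F_op_qconst_mult by (simp add: algebra_simps)
  also have "qconst (of_nat g - of_int (i - 2 * int (Suc n)))
         + qconst (of_nat (Suc n) * (of_nat g - of_int i + of_nat n))
      = qconst (of_nat (Suc (Suc n)) * (of_nat g - of_int i + of_nat (Suc n)))"
    unfolding qconst_add by (rule arg_cong[of _ _ qconst]) (simp add: algebra_simps)
  finally show ?case
    by simp
qed

text \<open>Here \<open>Suc n\<close> applications would bring \<open>p\<close> to first degree -2,
  so only the scalar term survives. With \<open>i = 2 * n\<close> the scalar has the factor
  \<open>g - n\<close>, which vanishes exactly at \<open>n = g\<close>.\<close>

lemma F_op_pow_x20_mult_bottom:
  assumes "g \<ge> 1" "p \<in> A_comp g (2 * int n) j"
  shows "(F_op g ^^ Suc n) (qvar (XV 2 0) * p)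
    = qconst (of_nat (Suc n) * (of_nat g - of_nat n)) * (F_op g ^^ n) p"
proof -
  have "(F_op g ^^ Suc n) p = 0"
    using A_comp_neg[OF _ A_comp_F_op_pow[OF assms(2), of "Suc n"]] by simp
  then show ?thesis
    unfolding F_op_pow_x20_mult[OF assms] by (simp add: algebra_simps)
qed

section \<open>Vanishing of the relations of low second degree\<close>

lemma lookup_x20_nonzero:
  assumes "keys m \<subseteq> A_vars g" "mon_bideg m = (i, j)" "i > 3 * j"
  shows "lookup m (XV 2 0) \<noteq> 0"
proof
  assume 0: "lookup m (XV 2 0) = 0"
  \<comment> \<open>For \<open>l = 0\<close>, parity and the exclusion of \<open>(0, 0)\<close>
    leave only \<open>XV 2 0\<close>, which is assumed absent. For \<open>l \<ge> 1\<close> one has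
    \<open>k \<le> l + 2 \<le> 3 * l\<close>.\<close>
  have "int (lookup m (XV k l)) * k \<le> 3 * (int (lookup m (XV k l)) * l)" if "(k, l) \<in> x_index g" for k l
  proof (cases "l = 0")
    case True
    then have "k = 2"
      using that by (cases "k = 1") (auto simp: x_index_def)
    then show ?thesis
      using 0 True by simp
  next
    case False
    then have "k \<le> 3 * l"
      using that by (auto simp: x_index_def)
    then have "int (lookup m (XV k l)) * k \<le> int (lookup m (XV k l)) * (3 * l)"
      by (intro mult_left_mono) auto
    then show ?thesis
      by simp
  qed
  then have "(\<Sum>(k, l)\<in>x_index g. int (lookup m (XV k l)) * k)
      \<le> (\<Sum>(k, l)\<in>x_index g. 3 * (int (lookup m (XV k l)) * l))"
    by (intro sum_mono) auto
  also have "\<dots> = 3 * (\<Sum>(k, l)\<in>x_index g. int (lookup m (XV k l)) * l)"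
    by (simp add: sum_distrib_left split_beta)
  also have "\<dots> \<le> 3 * snd (mon_bideg m)"
    by (simp add: mon_bideg_expand(2)[OF assms(1)])
  finally show False
    using assms by (simp flip: mon_bideg_expand(1)[OF assms(1)])
qed

text \<open>As \<open>2 * n > 2 * g \<ge> 3 * j\<close>, a factor \<open>XV 2 0\<close> can be split
  off. Repeating this lowers \<open>n\<close> one at a time until the scalar with the factor
  \<open>g - g\<close> appears.\<close>

lemma F_op_pow_monomial_eq_0:
  assumes "g \<ge> 1" "keys m \<subseteq> A_vars g" "mon_bideg m = (2 * int n, j)" "n > g" "3 * j \<le> 2 * int g"
  shows "(F_op g ^^ n) (single m 1) = 0"
  using assms(2-4)
proof (induction n arbitrary: m)
  case (Suc n)
  let ?r = "m - evar (XV 2 0)"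
  have *: "evar (XV 2 0) + ?r = m"
    using lookup_x20_nonzero[of m g] Suc.prems assms(5) by (intro evar_diff) auto
  have r: "keys ?r \<subseteq> A_vars g"
    using keys_diff_nat[of m] Suc.prems(1) by blast
  have "mon_bideg m = mon_bideg (evar (XV 2 0) + ?r)"
    by (simp add: *)
  then have b: "mon_bideg ?r = (2 * int n, j)"
    using Suc.prems(2) by (cases "mon_bideg ?r") (auto simp: mon_bideg_add)
  have "single m 1 = qvar (XV 2 0) * (single ?r 1 :: xy_var qpoly)"
    by (simp add: qvar_evar mult_single *)
  then have "(F_op g ^^ Suc n) (single m 1)
      = qconst (of_nat (Suc n) * (of_nat g - of_nat n)) * (F_op g ^^ n) (single ?r 1)"
    using F_op_pow_x20_mult_bottom[OF assms(1), of "single ?r 1" n j] r b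
    by (simp add: A_comp_iff)
  also have "\<dots> = 0"
    using Suc.IH[OF r b] Suc.prems(3) by (cases "n = g") auto
  finally show ?case .
qed auto

section \<open>Absence of cancellation\<close>

definition mon_sign :: "('v \<Rightarrow>\<^sub>0 nat) \<Rightarrow> rat" where
  "mon_sign m = (- 1) ^ (\<Sum>v\<in>keys m. lookup m v)"

lemma mon_sign_add: "mon_sign (m + n) = mon_sign m * mon_sign n"
  using wt_add[where f = "\<lambda>_. 1 :: nat", of m n] by (simp add: mon_sign_def power_add)

lemma mon_sign_evar [simp]: "mon_sign (evar v) = - 1"
  by (simp add: mon_sign_def lookup_evar)

text \<open>Among monomials in \<open>A_vars g\<close> these are the ones free of \<open>YV\<close>
  and \<open>XV 2 0\<close>, since \<open>(2, 0)\<close> is the only index with second entry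
  0.\<close>

definition pos_mon :: "(xy_var \<Rightarrow>\<^sub>0 nat) \<Rightarrow> bool" where
  "pos_mon m \<longleftrightarrow> (\<forall>v\<in>keys m. \<exists>i j. v = XV i j \<and> j \<ge> 1)"

text \<open>
  Each merging step of \<open>F\<close> carries a minus sign and lowers the degree by one, each shift
  \<open>x\<^bsub>i,j\<^esub> \<mapsto> x\<^bsub>i-2,j\<^esub>\<close> carries a plus sign and keeps the degree, so modulo \<open>y\<close> no
  cancellation occurs.  Excluding \<open>x\<^bsub>2,0\<^esub>\<close> is essential, since its shift is the constant \<open>g\<close>.
\<close>

definition sign_cone :: "xy_var qpoly set" where
  "sign_cone = {p. \<forall>m\<in>keys p. YV \<in> keys m \<or> pos_mon m \<and> 0 \<le> mon_sign m * lookup p m}"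

lemma sign_cone_0 [simp]: "0 \<in> sign_cone"
  by (simp add: sign_cone_def)

lemma sign_cone_nonneg:
  "p \<in> sign_cone \<Longrightarrow> YV \<notin> keys m \<Longrightarrow> 0 \<le> mon_sign m * lookup p m"
  by (cases "m \<in> keys p") (auto simp: sign_cone_def in_keys_iff[of m p])

lemma sign_cone_add:
  assumes "p \<in> sign_cone" "q \<in> sign_cone"
  shows "p + q \<in> sign_cone"
  unfolding sign_cone_def
proof (clarify)
  fix m assume m: "m \<in> keys (p + q)" "\<not> (pos_mon m \<and> 0 \<le> mon_sign m * lookup (p + q) m)"
  show "YV \<in> keys m"
  proof (rule ccontr)
    assume "YV \<notin> keys m"
    moreover from m(1) have "m \<in> keys p \<or> m \<in> keys q"
      using Poly_Mapping.keys_add[of p q] by auto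
    ultimately show False
      using m(2) assms sign_cone_nonneg[of p m] sign_cone_nonneg[of q m]
      by (auto simp: sign_cone_def lookup_add distrib_left)
  qed
qed

lemma sign_cone_sum: "(\<And>a. a \<in> A \<Longrightarrow> f a \<in> sign_cone) \<Longrightarrow> sum f A \<in> sign_cone"
  by (induction A rule: infinite_finite_induct) (simp_all add: sign_cone_add)

lemma sign_cone_single:
  "YV \<in> keys m \<or> c = 0 \<or> pos_mon m \<and> 0 \<le> mon_sign m * c \<Longrightarrow> single m c \<in> sign_cone"
  by (auto simp: sign_cone_def)

text \<open>Membership in the cone is a condition on each term separately, so stability under the
  linear operator \<open>F_op\<close> reduces to single terms.\<close>

lemma sign_cone_singleD:
  "p \<in> sign_cone \<Longrightarrow> single m (lookup p m) \<in> sign_cone"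
  by (rule sign_cone_single) (auto simp: sign_cone_def in_keys_iff[of m p])

lemma sign_cone_qconst_mult:
  assumes "0 \<le> c" "p \<in> sign_cone"
  shows "qconst c * p \<in> sign_cone"
proof -
  have "qconst c * p = (\<Sum>m\<in>keys p. single m (c * lookup p m))"
    by (subst poly_eq_sum_single[of p]) (simp add: sum_distrib_left qconst_single)
  moreover have "single m (c * lookup p m) \<in> sign_cone" if "m \<in> keys p" for m
    using that assms
    by (intro sign_cone_single) (auto simp: sign_cone_def mult.left_commute[of _ c])
  ultimately show ?thesis
    by (simp add: sign_cone_sum)
qed

section \<open>Stability of the sign cone under \<open>F\<close>\<close>

lemma keys_y_elem_mult: "m \<in> keys (y_elem * p) \<Longrightarrow> YV \<in> keys m"
  using keys_mult[of y_elem p] by (auto simp: y_elem_def qvar_evar keys_plus_nat)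

lemma keys_mult_single_YV:
  fixes p :: "xy_var qpoly"
  assumes "m \<in> keys (p * single r c)" "YV \<in> keys r"
  shows "YV \<in> keys m"
proof -
  obtain a b where "m = a + b" "b \<in> keys (single r c)"
    using assms(1) keys_mult[of p "single r c"] by blast
  then show ?thesis
    using assms(2) by (auto simp: keys_plus_nat split: if_splits)
qed

lemma y_elem_mult_in_sign_cone: "y_elem * p \<in> sign_cone"
  using keys_y_elem_mult by (auto simp: sign_cone_def)

lemma int_binom_nonneg:
  assumes "0 \<le> i" "0 \<le> k"
  shows "0 \<le> int_binom (i + k - 2) (i - 1)"
proof (cases "i + k - 2 \<ge> 0")
  case True
  then obtain n where "i + k - 2 = int n"
    using zero_le_imp_eq_int by blast
  then show ?thesis
    by (simp add: int_binom_def flip: binomial_gbinomial)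
next
  \<comment> \<open>Then \<open>i + k \<le> 1\<close>. For \<open>i = 0\<close> the lower argument
    is negative and the value is 0; for \<open>i = 1\<close>, \<open>k = 0\<close> it is -1 over 0,
    which is 1.\<close>
  case False
  then show ?thesis
    using assms by (cases "i = 1") (auto simp: int_binom_def)
qed

lemma int_binom_pos:
  assumes "1 \<le> i" "1 \<le> k"
  shows "0 < int_binom (i + k - 2) (i - 1)"
proof -
  obtain n where n: "i + k - 2 = int n"
    using assms zero_le_imp_eq_int[of "i + k - 2"] by auto
  then have "nat (i - 1) \<le> n"
    using assms by simp
  then show ?thesis
    using assms by (simp add: int_binom_def n flip: binomial_gbinomial)
qed

lemma xdiff_single:
  "xdiff v (single m c)
    = single (m - evar (XV (fst v) (snd v))) (of_nat (lookup m (XV (fst v) (snd v))) * c)"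
  by (simp add: xdiff_def pdiff_single)

lemma x_elem_eq_qvar: "(i, j) \<in> x_index g \<Longrightarrow> x_elem g i j = qvar (XV i j)"
  by (auto simp: x_elem_def x_index_def)

lemma x_elem_cases: "j \<ge> 1 \<Longrightarrow> x_elem g i j = 0 \<or> x_elem g i j = qvar (XV i j)"
  by (auto simp: x_elem_def)

lemma pos_mon_add: "pos_mon (m + n) \<longleftrightarrow> pos_mon m \<and> pos_mon n"
  by (auto simp: pos_mon_def keys_plus_nat)

lemma pos_mon_evar: "pos_mon (evar (XV i j)) \<longleftrightarrow> j \<ge> 1"
  by (simp add: pos_mon_def)

text \<open>A shift keeps the total degree, hence the sign, and multiplies by an exponent. The
  second index stays positive, so the result is a variable or 0 and never the constant
  \<open>g\<close>. A factor \<open>YV\<close> is preserved.\<close>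

lemma sign_cone_shift:
  assumes "single m c \<in> sign_cone"
  shows "x_elem g (fst v - 2) (snd v) * xdiff v (single m c) \<in> sign_cone"
proof -
  define ev where "ev = evar (XV (fst v) (snd v))"
  define r where "r = m - ev"
  define a where "a = lookup m (XV (fst v) (snd v))"
  have eq: "xdiff v (single m c) = single r (of_nat a * c)"
    by (simp add: xdiff_single ev_def r_def a_def)
  show ?thesis
  proof (cases "a = 0 \<or> c = 0")
    case True
    then show ?thesis by (auto simp: eq)
  next
    case False
    then have m: "m = ev + r"
      unfolding ev_def r_def a_def by (simp add: evar_diff)
    show ?thesis
    proof (cases "YV \<in> keys m")
      case True
      then have "YV \<in> keys r"
        by (simp add: m keys_plus_nat ev_def)
      then show ?thesis
        unfolding eq sign_cone_def using keys_mult_single_YV by blast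
    next
      case False
      then have "pos_mon m" and s: "0 \<le> mon_sign m * c"
        using assms \<open>\<not> (a = 0 \<or> c = 0)\<close> by (auto simp: sign_cone_def)
      then have p: "snd v \<ge> 1" "pos_mon r"
        by (auto simp: m pos_mon_add ev_def pos_mon_evar)
      have "0 \<le> of_nat a * (mon_sign m * c)"
        by (rule mult_nonneg_nonneg[OF of_nat_0_le_iff s])
      then have *: "0 \<le> - (mon_sign r * (of_nat a * c))"
        by (simp add: m mon_sign_add ev_def mult.left_commute)
      have "single (evar (XV (fst v - 2) (snd v)) + r) (of_nat a * c) \<in> sign_cone"
        using p * by (intro sign_cone_single) (simp add: pos_mon_add pos_mon_evar mon_sign_add)
      then show ?thesis
        using x_elem_cases[OF p(1), of g "fst v - 2"] by (auto simp: eq qvar_evar mult_single)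
    qed
  qed
qed

text \<open>Replacing two variables by one flips \<open>mon_sign\<close>, which the minus sign in
  \<open>F_coeff\<close> compensates; the binomial coefficient is nonnegative.\<close>

lemma sign_cone_merge:
  assumes "single m c \<in> sign_cone" "v \<in> x_index g" "w \<in> x_index g"
  shows "F_coeff g v w * xdiff v (xdiff w (single m c)) \<in> sign_cone"
proof -
  define ev where "ev = evar (XV (fst v) (snd v))"
  define ew where "ew = evar (XV (fst w) (snd w))"
  define r where "r = m - ew - ev"
  define a where "a = lookup m (XV (fst w) (snd w))"
  define b where "b = lookup (m - ew) (XV (fst v) (snd v))"
  define x where "x = x_elem g (fst v + fst w - 2) (snd v + snd w)"
  define k where "k = int_binom (fst v + fst w - 2) (fst v - 1)"
  have k: "k \<ge> 0"
    unfolding k_def using assms(2,3) by (intro int_binom_nonneg) (auto simp: x_index_def)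
  have eq: "xdiff v (xdiff w (single m c)) = single r (of_nat (b * a) * c)"
    by (simp add: xdiff_single ev_def ew_def r_def a_def b_def mult.assoc)
  \<comment> \<open>The first summand is a multiple of \<open>y_elem\<close> and lies in the cone in
    any case. In the second the minus sign is moved to \<open>q\<close>, leaving a nonnegative
    scalar.\<close>
  have split: "F_coeff g v w * q
      = y_elem * (x_elem g (fst v - 1) (snd v - 1) * x_elem g (fst w - 1) (snd w - 1) * q)
        + qconst k * (x * - q)" for q
    by (simp add: F_coeff_def x_def k_def algebra_simps)
  have "x * - single r (of_nat (b * a) * c) \<in> sign_cone"
  proof (cases "a = 0 \<or> b = 0 \<or> c = 0")
    case True
    then show ?thesis by auto
  next
    case False
    then have "m = ew + (m - ew)" "m - ew = ev + r"
      unfolding ev_def ew_def r_def a_def b_def by (simp_all add: evar_diff)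
    then have m: "m = ew + (ev + r)"
      by simp
    show ?thesis
    proof (cases "YV \<in> keys m")
      case True
      then have "YV \<in> keys r"
        by (simp add: m keys_plus_nat ev_def ew_def)
      then show ?thesis
        unfolding single_uminus[symmetric] sign_cone_def using keys_mult_single_YV by blast
    next
      case False
      then have "pos_mon m" and s: "0 \<le> mon_sign m * c"
        using assms(1) \<open>\<not> (a = 0 \<or> b = 0 \<or> c = 0)\<close> by (auto simp: sign_cone_def)
      then have p: "snd v \<ge> 1" "snd w \<ge> 1" "pos_mon r"
        by (auto simp: m pos_mon_add ev_def ew_def pos_mon_evar)
      have "0 \<le> of_nat (b * a) * (mon_sign m * c)"
        by (rule mult_nonneg_nonneg[OF of_nat_0_le_iff s])
      then have *: "0 \<le> mon_sign r * (of_nat (b * a) * c)"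
        by (simp add: m mon_sign_add ev_def ew_def mult.left_commute)
      have "single (evar (XV (fst v + fst w - 2) (snd v + snd w)) + r) (- (of_nat (b * a) * c))
          \<in> sign_cone"
        using p * by (intro sign_cone_single) (simp add: pos_mon_add pos_mon_evar mon_sign_add)
      then show ?thesis
        using x_elem_cases[of "snd v + snd w" g "fst v + fst w - 2"] p
        by (auto simp: x_def qvar_evar mult_single simp flip: single_uminus)
    qed
  qed
  then show ?thesis
    unfolding eq split using k
    by (intro sign_cone_add y_elem_mult_in_sign_cone sign_cone_qconst_mult)
qed

lemma sign_cone_F_op_single:
  assumes "single m c \<in> sign_cone"
  shows "F_op g (single m c) \<in> sign_cone"
  unfolding F_op_alt
  by (intro sign_cone_add sign_cone_qconst_mult sign_cone_sum sign_cone_merge sign_cone_shift assms) auto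

lemma sign_cone_F_op: "p \<in> sign_cone \<Longrightarrow> F_op g p \<in> sign_cone"
  by (subst poly_eq_sum_single[of p])
    (auto simp: F_op_sum intro!: sign_cone_sum sign_cone_F_op_single sign_cone_singleD)

lemma sign_cone_F_op_pow: "p \<in> sign_cone \<Longrightarrow> (F_op g ^^ n) p \<in> sign_cone"
  by (induction n) (auto intro: sign_cone_F_op)

section \<open>Strictly positive coefficients along a path of monomials\<close>

lemma sign_cone_decompose:
  assumes "p \<in> sign_cone"
  obtains q where "q \<in> sign_cone" "p = single m (lookup p m) + q"
proof
  let ?q = "\<Sum>n\<in>keys p - {m}. single n (lookup p n)"
  show "?q \<in> sign_cone"
    by (intro sign_cone_sum sign_cone_singleD assms)
  show "p = single m (lookup p m) + ?q"
  proof (cases "m \<in> keys p")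
    case True
    have "(\<Sum>n\<in>keys p. single n (lookup p n)) = single m (lookup p m) + ?q"
      by (rule sum.remove) (use True in auto)
    then show ?thesis
      using poly_eq_sum_single[of p] by simp
  next
    case False
    then show ?thesis
      using poly_eq_sum_single[of p] by (simp add: in_keys_iff)
  qed
qed

lemma sign_cone_pos_add:
  assumes "0 < mon_sign n * lookup p n" "q \<in> sign_cone" "YV \<notin> keys n"
  shows "0 < mon_sign n * lookup (p + q) n"
  using assms(1) sign_cone_nonneg[OF assms(2,3)] by (simp add: lookup_add distrib_left)

text \<open>The shift of the term at \<open>m\<close> contributes strictly positively at
  \<open>n\<close>. Everything else in \<open>F_op g p\<close> lies in the cone and cannot cancel
  it.\<close>

lemma F_op_shift_pos:
  assumes p: "p \<in> sign_cone" "m = evar (XV i j) + r" "0 < mon_sign m * lookup p m" "YV \<notin> keys r"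
    and ix: "(i, j) \<in> x_index g" "(i - 2, j) \<in> x_index g"
    and n: "n = evar (XV (i - 2) j) + r"
  shows "0 < mon_sign n * lookup (F_op g p) n"
proof -
  define c where "c = lookup p m"
  obtain q where q: "q \<in> sign_cone" "p = single m c + q"
    using sign_cone_decompose[OF p(1)] unfolding c_def by blast
  have mc: "single m c \<in> sign_cone"
    unfolding c_def by (rule sign_cone_singleD[OF p(1)])
  have YVn: "YV \<notin> keys n"
    using p(4) by (simp add: n keys_plus_nat)
  let ?S = "\<lambda>v. x_elem g (fst v - 2) (snd v) * xdiff v (single m c)"
  let ?T = "qconst (1 / 2) * (\<Sum>v\<in>x_index g. \<Sum>w\<in>x_index g. F_coeff g v w * xdiff v (xdiff w (single m c)))"
  have F: "F_op g p = ?S (i, j) + ((\<Sum>v\<in>x_index g - {(i, j)}. ?S v) + ?T + F_op g q)"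
    unfolding q(2) F_op_add F_op_alt[of g "single m c"]
    unfolding sum.remove[OF finite_x_index ix(1), of ?S] by (simp add: algebra_simps)
  have "?S (i, j) = single n (of_nat (lookup m (XV i j)) * c)"
    using x_elem_eq_qvar[OF ix(2)] by (simp add: xdiff_single qvar_evar mult_single n p(2))
  moreover have "mon_sign n = mon_sign m"
    by (simp add: n p(2) mon_sign_add)
  moreover have "0 < of_nat (lookup m (XV i j)) * (mon_sign m * c)"
    by (rule mult_pos_pos) (use p(3) in \<open>simp_all add: c_def p(2) lookup_add lookup_evar\<close>)
  ultimately have "0 < mon_sign n * lookup (?S (i, j)) n"
    by (simp add: mult_ac)
  then show ?thesis
    unfolding F
    by (rule sign_cone_pos_add)
      (intro sign_cone_add sign_cone_sum sign_cone_shift sign_cone_qconst_mult sign_cone_merge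
        sign_cone_F_op q(1) mc YVn, auto simp: YVn)
qed

text \<open>As for shifts, one merging term is isolated and the rest lies in the cone. First indices
  at least 1 make the binomial coefficient strictly positive.\<close>

lemma F_op_merge_pos:
  assumes p: "p \<in> sign_cone" "m = evar (XV k l) + (evar (XV i j) + r)" "0 < mon_sign m * lookup p m"
      "YV \<notin> keys r"
    and ix: "(i, j) \<in> x_index g" "(k, l) \<in> x_index g" "(i + k - 2, j + l) \<in> x_index g"
      "1 \<le> i" "1 \<le> k"
    and n: "n = evar (XV (i + k - 2) (j + l)) + r"
  shows "0 < mon_sign n * lookup (F_op g p) n"
proof -
  define c where "c = lookup p m"
  obtain q where q: "q \<in> sign_cone" "p = single m c + q"
    using sign_cone_decompose[OF p(1)] unfolding c_def by blast
  have mc: "single m c \<in> sign_cone"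
    unfolding c_def by (rule sign_cone_singleD[OF p(1)])
  have YVn: "YV \<notin> keys n"
    using p(4) by (simp add: n keys_plus_nat)
  let ?S = "\<Sum>v\<in>x_index g. x_elem g (fst v - 2) (snd v) * xdiff v (single m c)"
  let ?T = "\<lambda>v w. F_coeff g v w * xdiff v (xdiff w (single m c))"
  let ?R1 = "\<Sum>w\<in>x_index g - {(k, l)}. ?T (i, j) w"
  let ?R2 = "\<Sum>v\<in>x_index g - {(i, j)}. \<Sum>w\<in>x_index g. ?T v w"
  have "(\<Sum>v\<in>x_index g. \<Sum>w\<in>x_index g. ?T v w) = ?T (i, j) (k, l) + ?R1 + ?R2"
    unfolding sum.remove[OF finite_x_index ix(1), of "\<lambda>v. \<Sum>w\<in>x_index g. ?T v w"]
      sum.remove[OF finite_x_index ix(2), of "\<lambda>w. ?T (i, j) w"] by simp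
  then have F: "F_op g p = qconst (1 / 2) * ?T (i, j) (k, l) + (qconst (1 / 2) * (?R1 + ?R2) + ?S + F_op g q)"
    unfolding q(2) F_op_add F_op_alt[of g "single m c"] by (simp add: distrib_left)
  define b where "b = int_binom (i + k - 2) (i - 1)"
  define e where "e = of_nat (lookup (evar (XV i j) + r) (XV i j) * lookup m (XV k l)) * c"
  have D: "xdiff (i, j) (xdiff (k, l) (single m c)) = single r e"
    by (simp add: xdiff_single p(2) e_def mult.assoc)
  let ?Y = "y_elem * (x_elem g (i - 1) (j - 1) * x_elem g (k - 1) (l - 1) * single r e)"
  have T: "?T (i, j) (k, l) = ?Y + - single n (b * e)"
    unfolding D using x_elem_eq_qvar[OF ix(3)]
    by (simp add: F_coeff_def left_diff_distrib qvar_evar mult.assoc b_def qconst_single mult_single n)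
  \<comment> \<open>Every monomial of \<open>?Y\<close> contains \<open>YV\<close>, whereas
    \<open>n\<close> does not.\<close>
  have "lookup (qconst (1 / 2) * ?Y) n = 0"
    using keys_y_elem_mult[of n "qconst (1 / 2) * (x_elem g (i - 1) (j - 1) * x_elem g (k - 1) (l - 1) * single r e)"]
      YVn by (auto simp: in_keys_iff mult_ac)
  then have L: "lookup (qconst (1 / 2) * ?T (i, j) (k, l)) n = - (b * e / 2)"
    unfolding T distrib_left lookup_add by (simp add: qconst_single flip: single_uminus)
  have "mon_sign n = - mon_sign m"
    by (simp add: n p(2) mon_sign_add)
  moreover have "0 < (mon_sign m * c) * of_nat (lookup (evar (XV i j) + r) (XV i j) * lookup m (XV k l))"
    using p(3) unfolding c_def
    by (rule mult_pos_pos) (simp add: p(2) lookup_add lookup_evar del: of_nat_mult)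
  then have "0 < b * (mon_sign m * e)"
    by (intro mult_pos_pos[of b]) (use int_binom_pos[OF ix(4,5)] in \<open>simp_all add: b_def e_def mult_ac\<close>)
  ultimately have "0 < mon_sign n * lookup (qconst (1 / 2) * ?T (i, j) (k, l)) n"
    unfolding L by (simp add: mult_ac)
  then show ?thesis
    unfolding F
    by (rule sign_cone_pos_add)
      (intro sign_cone_add sign_cone_sum sign_cone_shift sign_cone_qconst_mult sign_cone_merge
        sign_cone_F_op q(1) mc YVn, auto simp: YVn ix)
qed

lemma F_op_pow_x31_pos:
  assumes "1 \<le> j" "j < g"
  defines "p \<equiv> single (single (XV 3 1) (2 * j)) (1 :: rat)"
  shows "lookup ((F_op g ^^ (3 * j)) p) (evar (XV 0 (2 * int j))) \<noteq> 0"
proof -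
  define N where "N = 2 * j"
  have N: "N \<ge> 2" "N \<le> 2 * g - 2" "even N"
    using assms by (auto simp: N_def)
  have sgn: "mon_sign (single (XV 3 1) N) = 1"
    using N by (simp add: mon_sign_def)
  have cone: "(F_op g ^^ n) p \<in> sign_cone" for n
    unfolding p_def using sgn
    by (intro sign_cone_F_op_pow sign_cone_single) (auto simp: pos_mon_def N_def)
  have single_Suc: "single (XV 3 1) (Suc k) = evar (XV 3 1) + single (XV 3 1) k" for k
    by (simp add: evar_def flip: single_add)
  \<comment> \<open>Merging \<open>XV i j\<close> with \<open>XV 3 1\<close> gives
    \<open>XV (i + 1) (j + 1)\<close>. After \<open>t\<close> merges one variable has absorbed
    \<open>t + 1\<close> of the \<open>N\<close> factors.\<close>
  have merge: "0 < mon_sign n * lookup ((F_op g ^^ t) p) n"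
    if "t < N" "n = evar (XV (int t + 3) (int t + 1)) + single (XV 3 1) (N - 1 - t)" for t n
    using that
  proof (induction t arbitrary: n)
    case 0
    have "n = single (XV 3 1) N"
      using single_Suc[of "N - 1"] 0 N by simp
    then show ?case
      using sgn by (simp add: p_def N_def)
  next
    case (Suc t)
    let ?m = "evar (XV (int t + 3) (int t + 1)) + single (XV 3 1) (N - 1 - t)"
    let ?r = "single (XV 3 1) (N - 1 - Suc t)"
    have "Suc (N - 1 - Suc t) = N - 1 - t"
      using Suc.prems(1) by simp
    then have m: "?m = evar (XV (int t + 3) (int t + 1)) + (evar (XV 3 1) + ?r)"
      using single_Suc[of "N - 1 - Suc t"] by simp
    show ?case
      unfolding funpow.simps o_apply
      by (rule F_op_merge_pos[OF cone m Suc.IH[OF _ refl], where g = g])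
        (use Suc.prems N in \<open>auto simp: x_index_def add_ac\<close>)
  qed
  \<comment> \<open>After \<open>N - 1\<close> merges only \<open>XV (N + 2) N\<close> is left, an
    index that \<open>j < g\<close> keeps within \<open>x_index g\<close>. From there each step
    lowers the first index by 2.\<close>
  have shift: "0 < mon_sign n * lookup ((F_op g ^^ (N - 1 + s)) p) n"
    if "s \<le> j + 1" "n = evar (XV (int N + 2 - 2 * int s) (int N))" for s n
    using that
  proof (induction s arbitrary: n)
    case 0
    then show ?case
      using merge[of "N - 1" n] N by (simp add: of_nat_diff add.commute)
  next
    case (Suc s)
    let ?m = "evar (XV (int N + 2 - 2 * int s) (int N))"
    have m: "?m = evar (XV (int N + 2 - 2 * int s) (int N)) + 0"
      by simp
    have "(F_op g ^^ (N - 1 + Suc s)) p = F_op g ((F_op g ^^ (N - 1 + s)) p)"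
      by simp
    then show ?case
      by (simp only:) (rule F_op_shift_pos[OF cone m Suc.IH[OF _ refl], where g = g],
        use Suc.prems N in \<open>auto simp: x_index_def N_def\<close>)
  qed
  have "N - 1 + (j + 1) = 3 * j"
    using assms by (simp add: N_def)
  then show ?thesis
    using shift[of "j + 1" "evar (XV 0 (2 * int j))"] by (auto simp: N_def)
qed

section \<open>The rings\<close>

lemma polys_in_iff: "p \<in> polys_in V \<longleftrightarrow> keys p \<subseteq> {m. keys m \<subseteq> V}"
  by (auto simp: polys_in_def)

lemma polys_in_add: "p \<in> polys_in V \<Longrightarrow> q \<in> polys_in V \<Longrightarrow> p + q \<in> polys_in V"
  by (simp add: polys_in_iff keys_add_subset)

lemma polys_in_uminus: "p \<in> polys_in V \<Longrightarrow> - p \<in> polys_in V"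
  by (simp add: polys_in_iff keys_uminus_subset)

lemma polys_in_mult: "p \<in> polys_in V \<Longrightarrow> q \<in> polys_in V \<Longrightarrow> p * q \<in> polys_in V"
  unfolding polys_in_iff by (erule (1) keys_mult_subset) (auto simp: keys_plus_nat)

lemma polys_in_0 [simp]: "0 \<in> polys_in V"
  by (simp add: polys_in_iff)

lemma polys_in_qconst [simp]: "qconst c \<in> polys_in V"
  using keys_qconst[of c] by (auto simp: polys_in_iff)

lemma polys_in_1 [simp]: "1 \<in> polys_in V"
  using polys_in_qconst[of 1] by simp

lemma polys_in_qvar [simp]: "qvar v \<in> polys_in V \<longleftrightarrow> v \<in> V"
  by (simp add: polys_in_iff qvar_evar)

lemma polys_in_sum: "(\<And>a. a \<in> A \<Longrightarrow> f a \<in> polys_in V) \<Longrightarrow> sum f A \<in> polys_in V"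
  by (simp add: polys_in_iff keys_sum_subset)

text \<open>Polynomials are built from constants and variables by sums and products. Monomials are
  treated by splitting off one variable, general polynomials by adding their terms one by
  one.\<close>

lemma polys_in_induct [consumes 1, case_names const var add mult]:
  assumes "p \<in> polys_in V"
    and const: "\<And>c. P (qconst c)" and var: "\<And>v. v \<in> V \<Longrightarrow> P (qvar v)"
    and add: "\<And>p q. p \<in> polys_in V \<Longrightarrow> q \<in> polys_in V \<Longrightarrow> P p \<Longrightarrow> P q \<Longrightarrow> P (p + q)"
    and mult: "\<And>p q. p \<in> polys_in V \<Longrightarrow> q \<in> polys_in V \<Longrightarrow> P p \<Longrightarrow> P q \<Longrightarrow> P (p * q)"
  shows "P p"
proof -
  have mon: "P (single m 1) \<and> single m 1 \<in> polys_in V" if "keys m \<subseteq> V" for m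
    using that
  proof (induction "\<Sum>v\<in>keys m. lookup m v" arbitrary: m rule: less_induct)
    case less
    show ?case
    proof (cases "keys m = {}")
      case True
      then show ?thesis
        using const[of 1] by simp
    next
      case False
      then obtain v where v: "v \<in> keys m"
        by blast
      let ?r = "m - evar v"
      have m: "evar v + ?r = m"
        using v by (intro evar_diff) (simp add: in_keys_iff)
      have r: "keys ?r \<subseteq> V"
        using less.prems keys_diff_nat[of m "evar v"] by auto
      have "(\<Sum>v\<in>keys ?r. lookup ?r v) < (\<Sum>v\<in>keys m. lookup m v)"
        using wt_add[where f = "\<lambda>_. 1 :: nat", of "evar v" ?r] by (simp add: m lookup_evar)
      then have IH: "P (single ?r 1)" "single ?r 1 \<in> polys_in V"
        using less.hyps r by auto
      have "single m 1 = qvar v * (single ?r 1 :: 'a qpoly)"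
        by (simp add: qvar_evar mult_single m)
      moreover have "v \<in> V"
        using v less.prems by auto
      ultimately show ?thesis
        using mult[of "qvar v" "single ?r 1"] var IH by (simp add: polys_in_mult)
    qed
  qed
  have "P (\<Sum>m\<in>M. single m (lookup p m)) \<and> (\<Sum>m\<in>M. single m (lookup p m)) \<in> polys_in V"
    if "finite M" "M \<subseteq> keys p" for M
    using that
  proof (induction M rule: finite_induct)
    case empty
    then show ?case
      using const[of 0] by simp
  next
    case (insert m M)
    then have "keys m \<subseteq> V"
      using assms(1) by (auto simp: polys_in_iff)
    then have "P (qconst (lookup p m) * single m 1)" "qconst (lookup p m) * single m 1 \<in> polys_in V"
      using mon[of m] const mult by (auto intro: polys_in_mult)
    then show ?case
      using insert add by (simp add: qconst_single polys_in_add)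
  qed
  from this[of "keys p"] show ?thesis
    by (simp flip: poly_eq_sum_single)
qed

section \<open>The ring \<open>A_ring g\<close>, its ideal of relations and the quotient\<close>

lemma A_ring_simps [simp]:
  "carrier (A_ring g) = polys_in (A_vars g)" "mult (A_ring g) = (*)" "one (A_ring g) = 1"
  "zero (A_ring g) = 0" "add (A_ring g) = (+)"
  by (simp_all add: A_ring_def)

lemma cring_A_ring: "cring (A_ring g)"
proof (rule cringI)
  show "abelian_group (A_ring g)"
  proof (rule abelian_groupI)
    fix x assume "x \<in> carrier (A_ring g)"
    then show "\<exists>y\<in>carrier (A_ring g). y \<oplus>\<^bsub>A_ring g\<^esub> x = \<zero>\<^bsub>A_ring g\<^esub>"
      by (intro bexI[of _ "- x"]) (auto simp: polys_in_uminus)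
  qed (auto simp: polys_in_add add_ac)
  show "comm_monoid (A_ring g)"
    by (rule comm_monoidI) (auto simp: polys_in_mult mult_ac)
qed (auto simp: distrib_right)

lemma ring_A_ring: "ring (A_ring g)"
  using cring_A_ring by (rule cring.axioms(1))

lemma a_inv_A_ring:
  assumes "p \<in> polys_in (A_vars g)"
  shows "\<ominus>\<^bsub>A_ring g\<^esub> p = - p"
proof -
  interpret ring "A_ring g" by (rule ring_A_ring)
  show ?thesis
    by (rule minus_equality) (use assms in \<open>auto simp: polys_in_uminus\<close>)
qed

lemma A_comp_subset: "A_comp g i j \<subseteq> polys_in (A_vars g)"
  by (auto simp: A_comp_def)

lemma single_in_A_comp:
  "keys m \<subseteq> A_vars g \<Longrightarrow> mon_bideg m = (i, j) \<Longrightarrow> single m c \<in> A_comp g i j"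
  by (auto simp: A_comp_iff)

lemma T_relationsI:
  assumes "keys m \<subseteq> A_vars g" "mon_bideg m = (i, j)" "i > 2 * int g"
  shows "(F_op g ^^ n) (single m 1) \<in> T_relations g"
proof -
  have "single m 1 \<in> Mon g i j"
    using assms(1,2) by (auto simp: Mon_def)
  then show ?thesis
    using assms(3) unfolding T_relations_def by blast
qed

text \<open>Each relation is bihomogeneous; the last property records its bidegree.\<close>

lemma T_relationsE:
  assumes "p \<in> T_relations g"
  obtains n :: nat and i j m where "p = (F_op g ^^ n) (single m 1)" "i > 2 * int g"
    "keys m \<subseteq> A_vars g" "mon_bideg m = (i, j)" "p \<in> A_comp g (i - 2 * int n) j"
proof -
  from assms obtain n :: nat and i j m where *: "p = (F_op g ^^ n) (single m 1)" "i > 2 * int g"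
    "keys m \<subseteq> A_vars g" "mon_bideg m = (i, j)"
    unfolding T_relations_def Mon_def by blast
  have "p \<in> A_comp g (i - 2 * int n) j"
    unfolding *(1) by (intro A_comp_F_op_pow single_in_A_comp *)
  with * show ?thesis
    by (rule that)
qed

lemma T_relations_subset: "T_relations g \<subseteq> polys_in (A_vars g)"
  using A_comp_subset by (blast elim: T_relationsE)

lemma ideal_T_ideal: "ideal (T_ideal g) (A_ring g)"
  unfolding T_ideal_def
  by (rule ring.genideal_ideal[OF ring_A_ring]) (simp add: T_relations_subset)

lemma T_class_hom: "ring_hom_ring (A_ring g) (T_ring g) (T_class g)"
proof -
  have "T_class g = (+>\<^bsub>A_ring g\<^esub>) (T_ideal g)"
    by (rule ext) (simp add: T_class_def)
  then show ?thesis
    using ideal.rcos_ring_hom_ring[OF ideal_T_ideal] by (simp add: T_ring_def)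
qed

lemma T_class_eq_zero_iff:
  assumes "p \<in> polys_in (A_vars g)"
  shows "T_class g p = \<zero>\<^bsub>T_ring g\<^esub> \<longleftrightarrow> p \<in> T_ideal g"
proof -
  interpret ideal "T_ideal g" "A_ring g" by (rule ideal_T_ideal)
  show ?thesis
    using assms a_rcos_const[of p] a_rcos_self[of p]
    by (auto simp: T_class_def T_ring_def FactRing_def)
qed

section \<open>No relations in low degree\<close>

text \<open>An ideal spanned by monomials that bounds \<open>T_ideal g\<close> from above: it omits
  exactly the bidegrees in which no relation is to occur.\<close>

definition high_polys :: "nat \<Rightarrow> xy_var qpoly set" where
  "high_polys g = {p. keys p \<subseteq> {m. keys m \<subseteq> A_vars g \<and>
     \<not> (fst (mon_bideg m) = 0 \<and> snd (mon_bideg m) \<le> 2 * int (g div 3))}}"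

text \<open>Bidegrees are nonnegative, so if a product of two monomials has first degree 0 and small
  second degree, then so has each factor.\<close>

lemma high_polys_mult:
  assumes "p \<in> high_polys g" "q \<in> polys_in (A_vars g)"
  shows "q * p \<in> high_polys g"
  using assms unfolding high_polys_def polys_in_iff mem_Collect_eq
proof (elim keys_mult_subset[rotated])
  fix a b :: "xy_var \<Rightarrow>\<^sub>0 nat"
  assume a: "a \<in> {m. keys m \<subseteq> A_vars g}"
    and b: "b \<in> {m. keys m \<subseteq> A_vars g \<and>
     \<not> (fst (mon_bideg m) = 0 \<and> snd (mon_bideg m) \<le> 2 * int (g div 3))}"
  then show "a + b \<in> {m. keys m \<subseteq> A_vars g \<and>
     \<not> (fst (mon_bideg m) = 0 \<and> snd (mon_bideg m) \<le> 2 * int (g div 3))}"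
    using mon_bideg_nonneg[of a g] mon_bideg_nonneg[of b g]
    by (auto simp: keys_plus_nat mon_bideg_add)
qed

lemma ideal_high_polys: "ideal (high_polys g) (A_ring g)"
proof (rule idealI[OF ring_A_ring])
  have sub: "high_polys g \<subseteq> polys_in (A_vars g)"
    by (rule subsetI) (simp add: high_polys_def polys_in_iff, blast)
  show "subgroup (high_polys g) (add_monoid (A_ring g))"
  proof
    fix p assume p: "p \<in> high_polys g"
    have "inv\<^bsub>add_monoid (A_ring g)\<^esub> p = - p"
      using a_inv_A_ring[of p g] p sub by (auto simp: a_inv_def)
    then show "inv\<^bsub>add_monoid (A_ring g)\<^esub> p \<in> high_polys g"
      using p by (simp add: high_polys_def keys_uminus_subset)
  qed (use sub in \<open>auto simp: high_polys_def keys_add_subset\<close>)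
next
  fix a x assume "a \<in> high_polys g" "x \<in> carrier (A_ring g)"
  then show "x \<otimes>\<^bsub>A_ring g\<^esub> a \<in> high_polys g" "a \<otimes>\<^bsub>A_ring g\<^esub> x \<in> high_polys g"
    using high_polys_mult[of a g x] by (simp_all add: mult.commute)
qed

text \<open>By minimality of the generated ideal only the relations matter. One that falls into an
  omitted bidegree has \<open>i = 2 * n\<close> and hence \<open>n > g\<close>, and vanishes by
  \<open>F_op_pow_monomial_eq_0\<close>.\<close>

lemma T_ideal_subset_high_polys:
  assumes "g \<ge> 1"
  shows "T_ideal g \<subseteq> high_polys g"
  unfolding T_ideal_def
proof (rule ring.genideal_minimal[OF ring_A_ring ideal_high_polys], rule subsetI)
  fix p assume "p \<in> T_relations g"
  then obtain n :: nat and i j m where p: "p = (F_op g ^^ n) (single m 1)" "i > 2 * int g"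
    "keys m \<subseteq> A_vars g" "mon_bideg m = (i, j)" "p \<in> A_comp g (i - 2 * int n) j"
    by (rule T_relationsE)
  show "p \<in> high_polys g"
  proof (cases "i = 2 * int n \<and> j \<le> 2 * int (g div 3)")
    case True
    have "3 * j \<le> 2 * int g"
      using True by linarith
    then have "p = 0"
      using F_op_pow_monomial_eq_0[OF assms p(3), of n j] p True by simp
    then show ?thesis
      by (simp add: high_polys_def)
  next
    case False
    then show ?thesis
      using p(5) by (auto simp: high_polys_def A_comp_iff)
  qed
qed

lemma gen_polys_not_in_T_ideal:
  assumes "g \<ge> 1" "i \<le> g div 3" "p \<in> A_comp g 0 (2 * int i)" "p \<in> T_ideal g"
  shows "p = 0"
proof -
  have "p \<in> high_polys g"
    using assms T_ideal_subset_high_polys by blast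
  moreover have "2 * int i \<le> 2 * int (g div 3)"
    using assms(2) by simp
  ultimately have "keys p = {}"
    using assms(3) by (fastforce simp: high_polys_def A_comp_iff)
  then show ?thesis by simp
qed

section \<open>Generation\<close>

text \<open>The preimage side of the subring: the elements of \<open>A_ring g\<close> whose
  monomials all have first degree 0.\<close>

definition weight0 :: "nat \<Rightarrow> xy_var qpoly set" where
  "weight0 g = {p. keys p \<subseteq> {m. keys m \<subseteq> A_vars g \<and> fst (mon_bideg m) = 0}}"

lemma weight0_subset: "weight0 g \<subseteq> polys_in (A_vars g)"
  by (rule subsetI) (simp add: weight0_def polys_in_iff, blast)

lemma subring_weight0: "subring (weight0 g) (A_ring g)"
proof (rule ring.subringI[OF ring_A_ring])
  fix p q assume "p \<in> weight0 g" "q \<in> weight0 g"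
  then show "p \<otimes>\<^bsub>A_ring g\<^esub> q \<in> weight0 g"
    unfolding weight0_def mem_Collect_eq A_ring_simps
    by (rule keys_mult_subset) (auto simp: keys_plus_nat mon_bideg_add)
next
  fix p assume p: "p \<in> weight0 g"
  then have "\<ominus>\<^bsub>A_ring g\<^esub> p = - p"
    using weight0_subset by (blast intro: a_inv_A_ring)
  then show "\<ominus>\<^bsub>A_ring g\<^esub> p \<in> weight0 g"
    using p by (simp add: weight0_def keys_uminus_subset)
next
  show "weight0 g \<subseteq> carrier (A_ring g)"
    by (simp add: weight0_subset)
qed (simp_all add: weight0_subset weight0_def keys_add_subset)

text \<open>Every variable has even total bidegree. Hence the components of bidegree
  \<open>(0, 2 * i)\<close> already exhaust first degree 0.\<close>

lemma even_mon_bideg: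
  assumes "keys m \<subseteq> A_vars g" "fst (mon_bideg m) = 0"
  shows "even (snd (mon_bideg m))"
proof -
  have "fst (mon_bideg m) + snd (mon_bideg m)
      = 2 * int (lookup m YV) + (\<Sum>(k, l)\<in>x_index g. int (lookup m (XV k l)) * (k + l))"
    unfolding mon_bideg_expand[OF assms(1)] by (simp add: split_beta distrib_left sum.distrib)
  moreover have "even (\<Sum>(k, l)\<in>x_index g. int (lookup m (XV k l)) * (k + l))"
    by (rule dvd_sum) (auto simp: x_index_def)
  ultimately show ?thesis
    using assms(2) by simp
qed

lemma finsum_T_class:
  assumes "\<And>i. p i \<in> polys_in (A_vars g)"
  shows "finsum (T_ring g) (\<lambda>i. T_class g (p i)) {..n :: nat} = T_class g (\<Sum>i\<le>n. p i)"
proof -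
  interpret ring_hom_ring "A_ring g" "T_ring g" "T_class g" by (rule T_class_hom)
  have [simp]: "T_class g (p i) \<in> carrier (T_ring g)" for i
    using hom_closed[of "p i"] assms by simp
  show ?thesis
  proof (induction n)
    case (Suc n)
    then show ?case
      using hom_add[of "p (Suc n)" "\<Sum>i\<le>n. p i"] assms
      by (simp add: polys_in_sum add.commute)
  qed simp
qed

lemma carrier_R_ring: "carrier (R_ring g) = T_class g ` weight0 g"
proof (intro subset_antisym subsetI)
  fix x assume "x \<in> carrier (R_ring g)"
  then obtain n t where x: "x = finsum (T_ring g) t {..n :: nat}" and "\<forall>i. t i \<in> R_comp g i"
    by (auto simp: R_ring_def)
  then have "\<forall>i. \<exists>p. t i = T_class g p \<and> p \<in> A_comp g 0 (2 * int i)"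
    by (auto simp: R_comp_def T_comp_def)
  then obtain p where p: "\<And>i. t i = T_class g (p i)" "\<And>i. p i \<in> A_comp g 0 (2 * int i)"
    by metis
  have "t = (\<lambda>i. T_class g (p i))"
    using p(1) by auto
  then have "x = T_class g (\<Sum>i\<le>n. p i)"
    using finsum_T_class[of p g n, OF subsetD[OF A_comp_subset p(2)]] x by simp
  moreover have "(\<Sum>i\<le>n. p i) \<in> weight0 g"
    unfolding weight0_def mem_Collect_eq
    by (rule keys_sum_subset) (use p(2) in \<open>auto simp: A_comp_iff subset_iff\<close>)
  ultimately show "x \<in> T_class g ` weight0 g"
    by blast
next
  fix x assume "x \<in> T_class g ` weight0 g"
  then obtain p where x: "x = T_class g p" and p: "p \<in> weight0 g"
    by auto
  \<comment> \<open>\<open>q i\<close> is the component of \<open>p\<close> of second degree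
    \<open>2 * i\<close>. The number \<open>n\<close> below is a crude bound: the sum of all second
    degrees dominates each of them.\<close>
  define q where "q i = (\<Sum>m\<in>keys p. if snd (mon_bideg m) = 2 * int i then single m (lookup p m) else 0)"
    for i :: nat
  define n where "n = (\<Sum>m\<in>keys p. nat (snd (mon_bideg m)))"
  have q: "q i \<in> A_comp g 0 (2 * int i)" for i
    unfolding q_def
  proof (intro A_comp_sum)
    fix m assume "m \<in> keys p"
    then show "(if snd (mon_bideg m) = 2 * int i then single m (lookup p m) else 0)
        \<in> A_comp g 0 (2 * int i)"
      using p by (cases "mon_bideg m") (auto simp: weight0_def intro!: single_in_A_comp)
  qed
  have "(\<Sum>i\<le>n. q i)
      = (\<Sum>m\<in>keys p. \<Sum>i\<le>n. if snd (mon_bideg m) = 2 * int i then single m (lookup p m) else 0)"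
    unfolding q_def by (rule sum.swap)
  also have "\<dots> = (\<Sum>m\<in>keys p. single m (lookup p m))"
  proof (rule sum.cong[OF refl])
    fix m assume m: "m \<in> keys p"
    then have *: "keys m \<subseteq> A_vars g" "fst (mon_bideg m) = 0"
      using p by (auto simp: weight0_def)
    obtain k where k: "snd (mon_bideg m) = 2 * int k"
    proof
      show "snd (mon_bideg m) = 2 * int (nat (snd (mon_bideg m) div 2))"
        using even_mon_bideg[OF *] mon_bideg_nonneg(2)[OF *(1)] by auto
    qed
    have "nat (snd (mon_bideg m)) \<le> n"
      unfolding n_def using m by (intro member_le_sum) auto
    then have "k \<le> n"
      using k by simp
    then show "(\<Sum>i\<le>n. if snd (mon_bideg m) = 2 * int i then single m (lookup p m) else 0)
        = single m (lookup p m)"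
      by (simp add: k)
  qed
  finally have "(\<Sum>i\<le>n. q i) = p"
    by (simp flip: poly_eq_sum_single)
  then have "x = finsum (T_ring g) (\<lambda>i. T_class g (q i)) {..n}"
    using finsum_T_class[of q g n, OF subsetD[OF A_comp_subset q]] x by simp
  moreover have "T_class g (q i) \<in> R_comp g i" for i
    using q by (auto simp: R_comp_def T_comp_def)
  ultimately show "x \<in> carrier (R_ring g)"
    by (auto simp: R_ring_def)
qed

lemma R_ring_eq: "R_ring g = (T_ring g)\<lparr>carrier := T_class g ` weight0 g\<rparr>"
  unfolding carrier_R_ring[symmetric] by (simp add: R_ring_def)

lemma ring_R_ring: "ring (R_ring g)"
proof -
  interpret ring_hom_ring "A_ring g" "T_ring g" "T_class g" by (rule T_class_hom)
  show ?thesis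
    unfolding R_ring_eq by (rule S.subring_is_ring[OF img_is_subring[OF subring_weight0]])
qed

section \<open>Variables occurring in first degree 0\<close>

lemma mon_bideg_remove:
  assumes "v \<in> keys m"
  shows "mon_bideg m = (fst (var_bideg v) + fst (mon_bideg (m - evar v)),
    snd (var_bideg v) + snd (mon_bideg (m - evar v)))"
proof -
  have "evar v + (m - evar v) = m"
    using assms by (intro evar_diff) (simp add: in_keys_iff)
  then show ?thesis
    using mon_bideg_add[of "evar v" "m - evar v"] by simp
qed

text \<open>Removing \<open>v\<close> leaves a monomial of nonnegative bidegree, so \<open>v\<close>
  itself has first degree at most 0 and second degree at most \<open>b\<close>.\<close>

lemma keys_weight0_monomial:
  assumes "keys m \<subseteq> A_vars g" "mon_bideg m = (0, b)" "v \<in> keys m"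
  shows "v = YV \<or> (\<exists>l. 1 \<le> l \<and> l < g \<and> 2 * int l \<le> b \<and> v = XV 0 (2 * int l))"
proof (cases v)
  case (XV i j)
  have "keys (m - evar v) \<subseteq> A_vars g"
    using assms(1) keys_diff_nat[of m "evar v"] by auto
  from mon_bideg_nonneg[OF this] have "i \<le> 0" "j \<le> b"
    using mon_bideg_remove[OF assms(3)] assms(2) XV by auto
  moreover have ij: "(i, j) \<in> x_index g"
    using assms(1,3) XV by (auto simp: A_vars_def)
  ultimately have i: "i = 0" and j: "0 < j" "even j" "j \<le> 2 * int g - 2" "j \<le> b"
    by (auto simp: x_index_def)
  then have l: "2 * int (nat (j div 2)) = j" "1 \<le> nat (j div 2)" "nat (j div 2) < g"
    by auto
  have "\<exists>l. 1 \<le> l \<and> l < g \<and> 2 * int l \<le> b \<and> v = XV 0 (2 * int l)"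
    by (rule exI[of _ "nat (j div 2)"]) (simp only: l XV i j simp_thms order_refl)
  then show ?thesis ..
qed simp

lemma mon_bideg_eq_0:
  assumes "keys m \<subseteq> A_vars g" "mon_bideg m = (0, 0)"
  shows "m = 0"
proof (rule ccontr)
  assume "m \<noteq> 0"
  then obtain v where v: "v \<in> keys m"
    using keys_eq_empty[of m] by blast
  have "keys (m - evar v) \<subseteq> A_vars g"
    using assms(1) keys_diff_nat[of m "evar v"] by auto
  from mon_bideg_nonneg[OF this] have "fst (var_bideg v) \<le> 0" "snd (var_bideg v) \<le> 0"
    using mon_bideg_remove[OF v] assms(2) by auto
  moreover have "v \<in> A_vars g"
    using v assms(1) by blast
  ultimately show False
    by (auto simp: A_vars_def x_index_def)
qed

section \<open>The subalgebra generated by the classes of \<open>gen_vars g\<close>\<close>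

lemma gen_vars_subset: "g \<ge> 2 \<Longrightarrow> gen_vars g \<subseteq> A_vars g"
proof
  fix v assume g: "g \<ge> 2" and "v \<in> gen_vars g"
  then consider "v = YV" | m where "1 \<le> m" "m \<le> g div 3" "v = XV 0 (2 * int m)"
    by (auto simp: gen_vars_def)
  then show "v \<in> A_vars g"
  proof cases
    case 2
    then have "(0, 2 * int m) \<in> x_index g"
      using g by (auto simp: x_index_def)
    then show ?thesis
      using 2 by (auto simp: A_vars_def)
  qed (simp add: A_vars_def)
qed

lemma var_bideg_gen_vars: "v \<in> gen_vars g \<Longrightarrow> fst (var_bideg v) = 0"
  by (auto simp: gen_vars_def)

lemma R_generated_subset:
  assumes "g \<ge> 2"
  shows "R_generated g ((\<lambda>v. T_class g (qvar v)) ` gen_vars g) \<subseteq> carrier (R_ring g)"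
  unfolding R_generated_def
proof (rule subsetI, rule ring.generate_ring_in_carrier[OF ring_R_ring])
  have "qvar v \<in> weight0 g" if "v \<in> gen_vars g" for v
    using that gen_vars_subset[OF assms] var_bideg_gen_vars[OF that]
    by (auto simp: weight0_def qvar_evar)
  moreover have "qconst c \<in> weight0 g" for c
    using keys_qconst[of c] by (auto simp: weight0_def)
  ultimately show "R_scalars g \<union> (\<lambda>v. T_class g (qvar v)) ` gen_vars g \<subseteq> carrier (R_ring g)"
    by (auto simp: carrier_R_ring R_scalars_def)
qed

text \<open>The preimage of the generated subalgebra in \<open>A_ring g\<close>, so that the
  elimination of variables can be carried out with polynomials.\<close>

definition generated_polys :: "nat \<Rightarrow> xy_var qpoly set" where
  "generated_polys g = {p \<in> polys_in (A_vars g).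
     T_class g p \<in> R_generated g ((\<lambda>v. T_class g (qvar v)) ` gen_vars g)}"

lemma generated_polys_qconst: "qconst c \<in> generated_polys g"
  unfolding generated_polys_def R_generated_def R_scalars_def
  by (auto intro: generate_ring.incl)

lemma generated_polys_add:
  assumes "p \<in> generated_polys g" "q \<in> generated_polys g"
  shows "p + q \<in> generated_polys g"
proof -
  interpret ring_hom_ring "A_ring g" "T_ring g" "T_class g" by (rule T_class_hom)
  show ?thesis
    using assms hom_add[of p q] generate_ring.eng_add[where R = "R_ring g"]
    by (auto simp: generated_polys_def R_generated_def polys_in_add R_ring_def)
qed

lemma generated_polys_mult:
  assumes "p \<in> generated_polys g" "q \<in> generated_polys g"
  shows "p * q \<in> generated_polys g"
proof -
  interpret ring_hom_ring "A_ring g" "T_ring g" "T_class g" by (rule T_class_hom)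
  show ?thesis
    using assms hom_mult[of p q] generate_ring.eng_mult[where R = "R_ring g"]
    by (auto simp: generated_polys_def R_generated_def polys_in_mult R_ring_def)
qed

lemma polys_in_subset_generated_polys:
  assumes "\<And>v. v \<in> V \<Longrightarrow> qvar v \<in> generated_polys g" "p \<in> polys_in V"
  shows "p \<in> generated_polys g"
  using assms(2)
  by (induction rule: polys_in_induct)
    (simp_all add: assms(1) generated_polys_qconst generated_polys_add generated_polys_mult)

text \<open>The class of such a polynomial is 0, the class of the scalar
  \<open>qconst 0\<close>.\<close>

lemma T_ideal_subset_generated_polys: "T_ideal g \<subseteq> generated_polys g"
proof
  fix p assume p: "p \<in> T_ideal g"
  interpret ideal "T_ideal g" "A_ring g" by (rule ideal_T_ideal)
  have "p \<in> polys_in (A_vars g)"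
    using p a_subset by auto
  moreover from this have "T_class g p = T_class g (qconst 0)"
    using p T_class_eq_zero_iff[of p g] T_class_eq_zero_iff[of 0 g] additive_subgroup.zero_closed[OF is_additive_subgroup] by simp
  ultimately show "p \<in> generated_polys g"
    using generated_polys_qconst[of 0 g] by (simp add: generated_polys_def)
qed

lemma generated_polys_gen_var:
  assumes "g \<ge> 2" "v \<in> gen_vars g"
  shows "qvar v \<in> generated_polys g"
  using assms gen_vars_subset[OF assms(1)] unfolding generated_polys_def R_generated_def
  by (auto intro!: generate_ring.incl)

text \<open>Strong induction on \<open>j\<close>: beyond \<open>g div 3\<close>, the relation
  obtained from \<open>?M\<close> contains \<open>XV 0 (2 * int j)\<close> with nonzero coefficient
  and can be solved for it.\<close>

lemma generated_polys_x0:
  assumes "g \<ge> 2" "1 \<le> j" "j < g"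
  shows "qvar (XV 0 (2 * int j)) \<in> generated_polys g"
  using assms(2,3)
proof (induction j rule: less_induct)
  case (less j)
  show ?case
  proof (cases "j \<le> g div 3")
    case True
    then show ?thesis
      using less.prems by (intro generated_polys_gen_var assms(1)) (auto simp: gen_vars_def)
  next
    case False
    let ?x = "evar (XV 0 (2 * int j))" and ?M = "single (XV 3 1) (2 * j)"
    define P where "P = (F_op g ^^ (3 * j)) (single ?M 1)"
    define c where "c = lookup P ?x"
    have c: "c \<noteq> 0"
      unfolding c_def P_def using F_op_pow_x31_pos[OF less.prems] .
    have M: "keys ?M \<subseteq> A_vars g" "mon_bideg ?M = (6 * int j, 2 * int j)"
      using assms(1) by (auto simp: A_vars_def x_index_def mon_bideg_def)
    \<comment> \<open>From \<open>j > g div 3\<close> follows \<open>3 * j > g\<close>, so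
      \<open>?M\<close> has first degree beyond the bound that makes it a source of
      relations.\<close>
    have "6 * int j > 2 * int g"
      using False by linarith
    then have "P \<in> T_relations g"
      unfolding P_def using M by (rule T_relationsI[rotated -1])
    then have "P \<in> T_ideal g"
      using ring.genideal_self[OF ring_A_ring, of "T_relations g" g] T_relations_subset
      by (auto simp: T_ideal_def)
    then have Pgen: "P \<in> generated_polys g"
      using T_ideal_subset_generated_polys by blast
    have P: "P \<in> A_comp g 0 (2 * int j)"
      using A_comp_F_op_pow[OF single_in_A_comp[OF M], of "3 * j" 1] by (simp add: P_def)
    define q where "q = P + qconst (- c) * qvar (XV 0 (2 * int j))"
    let ?V = "insert YV ((\<lambda>l. XV 0 (2 * int l)) ` {l. 1 \<le> l \<and> l < j})"
    have "q \<in> polys_in ?V"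
      unfolding polys_in_iff
    proof (intro subsetI CollectI)
      fix m v assume m: "m \<in> keys q" and v: "v \<in> keys m"
      have q: "lookup q m = lookup P m - (if m = ?x then c else 0)"
        by (auto simp: q_def qvar_evar qconst_single lookup_add lookup_single when_def)
      then have "m \<noteq> ?x" "m \<in> keys P"
        using m unfolding in_keys_iff[of m q] in_keys_iff[of m P] by (cases "m = ?x"; simp add: c_def)+
      then have mA: "keys m \<subseteq> A_vars g" and bi: "mon_bideg m = (0, 2 * int j)"
        using P by (auto simp: A_comp_iff)
      \<comment> \<open>A monomial of bidegree \<open>(0, 2 * j)\<close> containing this variable
        has a cofactor of bidegree \<open>(0, 0)\<close>, hence equals \<open>?x\<close>, whose term
        was removed from \<open>P\<close>.\<close>
      have "v \<noteq> XV 0 (2 * int j)"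
      proof
        assume v': "v = XV 0 (2 * int j)"
        have "mon_bideg (m - ?x) = (0, 0)"
          using mon_bideg_remove[OF v] bi v' by (cases "mon_bideg (m - ?x)") auto
        then have "m - ?x = 0"
          using mA keys_diff_nat[of m ?x] by (intro mon_bideg_eq_0[of _ g]) auto
        moreover have "?x + (m - ?x) = m"
          using v v' by (intro evar_diff) (simp add: in_keys_iff)
        ultimately have "m = ?x"
          by simp
        then show False
          using \<open>m \<noteq> ?x\<close> by simp
      qed
      moreover from keys_weight0_monomial[OF mA bi v]
      have "v = YV \<or> (\<exists>l. 1 \<le> l \<and> l \<le> j \<and> v = XV 0 (2 * int l))"
        by auto
      ultimately consider "v = YV" | l where "1 \<le> l" "l < j" "v = XV 0 (2 * int l)"
        by (metis nat_less_le)
      then show "v \<in> ?V"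
        by cases auto
    qed
    moreover have "qvar v \<in> generated_polys g" if v: "v \<in> ?V" for v
    proof (cases "v = YV")
      case True
      then show ?thesis
        by (intro generated_polys_gen_var assms(1)) (simp add: gen_vars_def)
    next
      case False
      then obtain l where "1 \<le> l" "l < j" "v = XV 0 (2 * int l)"
        using v by auto
      then show ?thesis
        using less.IH[of l] less.prems by simp
    qed
    ultimately have qgen: "q \<in> generated_polys g"
      using polys_in_subset_generated_polys[of ?V g q] by simp
    have "qvar (XV 0 (2 * int j)) = qconst (1 / c) * P + qconst (- 1 / c) * q"
    proof -
      have "qconst (- 1 / c) * q
          = qconst (- 1 / c) * P + qconst (- 1 / c * - c) * qvar (XV 0 (2 * int j))"
        unfolding q_def distrib_left mult.assoc[symmetric] qconst_mult ..
      moreover have "qconst (1 / c) * P + qconst (- 1 / c) * P = 0"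
        unfolding distrib_right[symmetric] qconst_add by simp
      ultimately show ?thesis
        using c by (simp add: add.assoc[symmetric])
    qed
    then show ?thesis
      using Pgen qgen by (simp add: generated_polys_add generated_polys_mult generated_polys_qconst)
  qed
qed

text \<open>In first degree 0 only \<open>YV\<close> and the \<open>XV 0 (2 * int l)\<close> with
  \<open>1 \<le> l < g\<close> occur, and all of these are already known to be generated.\<close>

lemma weight0_subset_generated_polys:
  assumes "g \<ge> 2"
  shows "weight0 g \<subseteq> generated_polys g"
proof
  fix p assume p: "p \<in> weight0 g"
  let ?V = "insert YV ((\<lambda>l. XV 0 (2 * int l)) ` {l. 1 \<le> l \<and> l < g})"
  have "p \<in> polys_in ?V"
    unfolding polys_in_iff
  proof (intro subsetI CollectI)
    fix m v assume "m \<in> keys p" and v: "v \<in> keys m"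
    then have m: "keys m \<subseteq> A_vars g" "fst (mon_bideg m) = 0"
      using p by (auto simp: weight0_def)
    then have "mon_bideg m = (0, snd (mon_bideg m))"
      by (metis prod.collapse)
    from keys_weight0_monomial[OF m(1) this v] show "v \<in> ?V"
      by auto
  qed
  moreover have "qvar v \<in> generated_polys g" if v: "v \<in> ?V" for v
  proof (cases "v = YV")
    case True
    then show ?thesis
      by (intro generated_polys_gen_var assms) (simp add: gen_vars_def)
  next
    case False
    then obtain l where "1 \<le> l" "l < g" "v = XV 0 (2 * int l)"
      using v by auto
    then show ?thesis
      using generated_polys_x0[OF assms] by simp
  qed
  ultimately show "p \<in> generated_polys g"
    using polys_in_subset_generated_polys[of ?V g p] by simp
qed

theorem theorem3p7:
  fixes g :: nat
  assumes "g \<ge> 2"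
  shows "carrier (R_ring g) = R_generated g ((\<lambda>v. T_class g (qvar v)) ` gen_vars g)
    \<and> (\<forall>i \<le> g div 3. \<forall>p \<in> gen_polys_of_degree g i.
          p \<noteq> 0 \<longrightarrow> T_class g p \<noteq> \<zero>\<^bsub>R_ring g\<^esub>)"
proof (intro conjI allI impI ballI)
  show "carrier (R_ring g) = R_generated g ((\<lambda>v. T_class g (qvar v)) ` gen_vars g)"
    using R_generated_subset[OF assms] weight0_subset_generated_polys[OF assms]
    by (auto simp: carrier_R_ring generated_polys_def)
next
  fix i p assume i: "i \<le> g div 3" and p: "p \<in> gen_polys_of_degree g i" and "p \<noteq> 0"
  have "p \<in> A_comp g 0 (2 * int i)"
    using p by (simp add: gen_polys_of_degree_def)
  moreover from this have "p \<notin> T_ideal g"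
    using gen_polys_not_in_T_ideal[of g i p] assms i \<open>p \<noteq> 0\<close> by auto
  ultimately show "T_class g p \<noteq> \<zero>\<^bsub>R_ring g\<^esub>"
    using T_class_eq_zero_iff[of p g] A_comp_subset by (auto simp: R_ring_def)
qed

end
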